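(* Let $g:\mathbb{R}\to\mathbb{R}$ be a $T$-periodic $C^1$ function with only finitely many critical points in every bounded interval. Let $0<a<1$ and let $(a_n)_{n=0}^\infty$ be a sequence of independent random variables on a probability space $(\Omega,\mathbb{P})$, with $a_n$ uniformly distributed on $(-a^n,a^n)$. Let $(b_n)_{n=0}^\infty$ be a sequence for which there exists $b>1$ with $b_{n+1}/b_n\ge b$ for all $n>0$, and assume $a^2b>1$. Let $\theta_n\in\mathbb{R}$. Put $f(x)=\sum_{n=0}^\infty a_n g(b_n x+\theta_n)$. Then almost surely the occupation measure $\mu$ of $f$ is absolutely continuous with respect to Lebesgue measure, with a density in $L^2$. Moreover, if $b_n=b^n$ for an integer $b>1$ and $\theta_n=0$ for every $n$, then the same conclusion holds with the assumption $a^2b>1$ replaced by $ab>1$.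
   Context: The occupation measure of $f$ is the Borel measure on $\mathbb{R}$ given by $\mu(S)=\mathcal{L}(\{x\in J: f(x)\in S\})$, where $J=[0,T]$ and $\mathcal{L}$ is Lebesgue measure. A critical point of $g$ is a point where $g'$ vanishes. *)

theory Defs
  imports "HOL-Probability.Probability"
begin

definition occupation_measure :: "real \<Rightarrow> (real \<Rightarrow> real) \<Rightarrow> real measure" where
  "occupation_measure T f = distr (restrict_space lborel {0..T}) borel f"

definition random_series ::
  "(nat \<Rightarrow> 'w \<Rightarrow> real) \<Rightarrow> (real \<Rightarrow> real) \<Rightarrow> (nat \<Rightarrow> real) \<Rightarrow> (nat \<Rightarrow> real) \<Rightarrow> 'w \<Rightarrow> real \<Rightarrow> real" where
  "random_series A g bs \<theta> \<omega> x = (\<Sum>n. A n \<omega> * g (bs n * x + \<theta> n))"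

definition abs_cont_L2_density :: "real measure \<Rightarrow> bool" where
  "abs_cont_L2_density \<mu> \<longleftrightarrow> absolutely_continuous lborel \<mu> \<and>
     (\<exists>h :: real \<Rightarrow> real. h \<in> borel_measurable borel \<and> (\<forall>x. 0 \<le> h x) \<and>
        \<mu> = density lborel (\<lambda>x. ennreal (h x)) \<and> integrable lborel (\<lambda>x. (h x)\<^sup>2))"

end

theory Submission
  imports Defs
begin

text \<open>
  The density is in \<open>L\<^sup>2\<close> as soon as the energies
  \<open>\<rho>\<inverse> |{(x, y) \<in> J \<times> J. |f x - f y| < \<rho>}|\<close> have a finite lower limit as \<open>\<rho> \<rightarrow> 0\<close>, and by Fatou it
  suffices to bound their expectations. Put \<open>\<Delta>\<^sub>n = g (b\<^sub>n x + \<theta>\<^sub>n) - g (b\<^sub>n y + \<theta>\<^sub>n)\<close>. Since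
  \<open>f x - f y\<close> is \<open>a\<^sub>n \<Delta>\<^sub>n\<close> plus an independent variable, it lies in \<open>(-\<rho>, \<rho>)\<close> with probability at most
  \<open>\<rho> / (a\<^sup>n |\<Delta>\<^sub>n|)\<close> for every \<open>n\<close>. Take for \<open>n\<close> the first multiple of \<open>L\<close> with \<open>|\<Delta>\<^sub>n| \<ge> \<delta>\<close>.

  If \<open>g\<close> has \<open>m - 1\<close> critical points per period, then \<open>{|g - c| < \<delta>}\<close> is covered by \<open>m\<close> intervals per
  period, of length at most \<open>2 \<epsilon>\<close> when \<open>\<delta>\<close> is small. Hence for fixed \<open>y\<close> the measure of the \<open>x\<close> with
  \<open>|\<Delta>\<^sub>L\<^sub>i| < \<delta>\<close> for \<open>1 \<le> i \<le> j\<close> decays like \<open>\<kappa>\<^sup>j\<close> with \<open>\<kappa> = m (2 \<epsilon> / T + 2 / b\<^sup>L)\<close>. Because \<open>m\<close> does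
  not depend on \<open>\<epsilon>\<close>, choosing first \<open>L\<close> and then \<open>\<epsilon>\<close> gives \<open>\<kappa> \<le> a\<^sup>L / 2\<close> whenever \<open>a b > 1\<close>, and the
  expected energies are bounded by a geometric series.
\<close>

section \<open>Nested level sets\<close>

text \<open>The critical points cut \<open>{0..T}\<close> into at most one more piece than there are
  critical points, and \<open>g\<close> is injective on each piece. Compactness makes this
  quantitative: points of one piece at distance at least \<open>\<epsilon>\<close> have values at
  least \<open>2 * \<delta>\<close> apart. The number of intervals depends on neither
  \<open>\<epsilon>\<close> nor \<open>c\<close>, which allows \<open>\<epsilon>\<close> to be
  chosen after it.\<close>

lemma level_set_cover:
  fixes g :: "real \<Rightarrow> real"
  assumes diff: "\<And>x. g differentiable (at x)"
    and fin: "finite {x \<in> {0..T}. deriv g x = 0}" and "0 < \<epsilon>"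
  obtains \<delta> where "0 < \<delta>"
    and "\<And>c. \<exists>S. finite S \<and> card S \<le> Suc (card {x \<in> {0..T}. deriv g x = 0}) \<and>
            {u \<in> {0..T}. \<bar>g u - c\<bar> < \<delta>} \<subseteq> (\<Union>s\<in>S. {s-\<epsilon>..s+\<epsilon>})"
proof -
  define Z where "Z = {x \<in> {0..T}. deriv g x = 0}"
  have cont: "continuous_on X g" for X
    by (meson diff continuous_at_imp_continuous_on differentiable_imp_continuous_within)
  \<comment> \<open>By Rolle, \<open>g\<close> separates the end points of every pair in the compact set \<open>K\<close>, hence uniformly.\<close>
  define K where "K = ({0..T} \<times> {0..T}) \<inter>
    ({p. snd p - fst p \<ge> \<epsilon>} \<inter> (\<Inter>z\<in>Z. {p. z \<le> fst p} \<union> {p. snd p \<le> z}))"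
  have "closed ({p::real\<times>real. snd p - fst p \<ge> \<epsilon>} \<inter> (\<Inter>z\<in>Z. {p. z \<le> fst p} \<union> {p. snd p \<le> z}))"
    by (intro closed_Int closed_INT closed_Un ballI closed_Collect_le continuous_intros)
  then have K: "compact K"
    unfolding K_def by (intro compact_Int_closed compact_Times) auto
  have pos: "0 < \<bar>g (fst p) - g (snd p)\<bar>" if "p \<in> K" for p
  proof (rule ccontr)
    assume "\<not> ?thesis"
    then have eq: "g (fst p) = g (snd p)" by simp
    obtain u v where p: "p = (u, v)" by (cases p)
    have uv: "u \<in> {0..T}" "v \<in> {0..T}" "v - u \<ge> \<epsilon>" and nz: "\<And>z. z \<in> Z \<Longrightarrow> z \<le> u \<or> v \<le> z"
      using that by (auto simp: K_def p)
    have "u < v" using uv \<open>0 < \<epsilon>\<close> by auto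
    then obtain z where z: "u < z" "z < v" "deriv g z = 0"
      using Rolle[of u v g] eq cont diff unfolding p
      by (metis DERIV_imp_deriv fst_conv snd_conv)
    then have "z \<in> Z" using z uv by (auto simp: Z_def)
    then show False using nz z by force
  qed
  \<comment> \<open>The factor 2 is there because two values within \<open>\<delta>\<close> of the
    same \<open>c\<close> are less than \<open>2 * \<delta>\<close> apart. If \<open>K\<close> is
    empty, any positive \<open>\<delta>\<close> will do.\<close>
  obtain \<delta> where \<delta>: "0 < \<delta>" "\<And>p. p \<in> K \<Longrightarrow> 2 * \<delta> \<le> \<bar>g (fst p) - g (snd p)\<bar>"
  proof (cases "K = {}")
    case True
    then show ?thesis using that[of 1] by auto
  next
    case False
    have "continuous_on K (\<lambda>p. \<bar>g (fst p) - g (snd p)\<bar>)"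
      by (intro continuous_intros continuous_on_compose2[OF cont[of UNIV]]) auto
    then obtain p0 where "p0 \<in> K" "\<forall>p\<in>K. \<bar>g (fst p0) - g (snd p0)\<bar> \<le> \<bar>g (fst p) - g (snd p)\<bar>"
      using continuous_attains_inf[OF K False] by blast
    then show ?thesis
      using pos[of p0] by (intro that[of "\<bar>g (fst p0) - g (snd p0)\<bar> / 2"]) auto
  qed
  have "\<exists>S. finite S \<and> card S \<le> Suc (card Z) \<and> {u \<in> {0..T}. \<bar>g u - c\<bar> < \<delta>} \<subseteq> (\<Union>s\<in>S. {s-\<epsilon>..s+\<epsilon>})" for c
  proof -
    define E where "E = {u \<in> {0..T}. \<bar>g u - c\<bar> < \<delta>}"
    \<comment> \<open>Points with equal \<open>key\<close> have no critical point between them.\<close>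
    define key where "key u = card (Z \<inter> {..<u})" for u
    define pick where "pick k = (SOME u. u \<in> E \<and> key u = k)" for k
    have finZ: "finite Z" using fin by (simp add: Z_def)
    have close: "v - u \<le> \<epsilon>" if "u \<in> E" "v \<in> E" "key u = key v" "u \<le> v" for u v
    proof (rule ccontr)
      assume "\<not> v - u \<le> \<epsilon>"
      have "Z \<inter> {..<u} = Z \<inter> {..<v}"
        using that finZ by (intro card_subset_eq) (auto simp: key_def)
      then have "z \<le> u \<or> v \<le> z" if "z \<in> Z" for z
        using that by (metis Int_iff lessThan_iff linorder_not_le less_imp_le)
      then have "(u, v) \<in> K"
        using that \<open>\<not> v - u \<le> \<epsilon>\<close> by (auto simp: K_def E_def)
      with \<delta>(2) have "2 * \<delta> \<le> \<bar>g u - g v\<bar>" by fastforce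
      then show False using that by (auto simp: E_def)
    qed
    define S where "S = pick ` {..card Z}"
    have "E \<subseteq> (\<Union>s\<in>S. {s-\<epsilon>..s+\<epsilon>})"
    proof
      fix u assume u: "u \<in> E"
      have s: "pick (key u) \<in> E \<and> key (pick (key u)) = key u"
        unfolding pick_def by (rule someI[of _ u]) (use u in auto)
      have "pick (key u) \<in> S"
        unfolding S_def key_def using finZ by (intro imageI) (auto intro: card_mono)
      moreover have "u \<in> {pick (key u) - \<epsilon>..pick (key u) + \<epsilon>}"
        using close[of u "pick (key u)"] close[of "pick (key u)" u] s u \<open>0 < \<epsilon>\<close> by force
      ultimately show "u \<in> (\<Union>s\<in>S. {s-\<epsilon>..s+\<epsilon>})" by blast
    qed
    moreover have "finite S" "card S \<le> Suc (card Z)"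
      unfolding S_def using card_image_le[of "{..card Z}" pick] by auto
    ultimately show ?thesis unfolding E_def by blast
  qed
  then show ?thesis using that \<delta>(1) unfolding Z_def by blast
qed

text \<open>Induction on the number of conditions, coarsest scale first. In each period the first
  condition confines \<open>x\<close> to at most \<open>m\<close> intervals of length
  \<open>2 * \<epsilon> / \<bar>\<beta> 0\<bar>\<close>, and the induction hypothesis for the
  shifted sequences is applied to each of them. The summand
  \<open>2 * T / \<bar>\<beta> 0\<bar>\<close> pays for periods that meet the interval only
  partially; at the next scale the growth by \<open>B\<close> turns it into the \<open>2 / B\<close>
  of the factor.\<close>

lemma nested_level_sets_measure:
  fixes g :: "real \<Rightarrow> real" and \<beta> \<theta> c :: "nat \<Rightarrow> real"
  assumes T: "0 < T" and periodic: "\<And>x. g (x + T) = g x" and cont: "continuous_on UNIV g"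
    and "0 < \<epsilon>" and "0 < B"
    and cover: "\<And>c. \<exists>S. finite S \<and> card S \<le> m \<and>
            {u \<in> {0..T}. \<bar>g u - c\<bar> < \<delta>} \<subseteq> (\<Union>s\<in>S. {s-\<epsilon>..s+\<epsilon>})"
    and "\<And>j. \<beta> j \<noteq> 0" and "\<And>j. B * \<bar>\<beta> j\<bar> \<le> \<bar>\<beta> (Suc j)\<bar>" and "0 \<le> l"
  shows "measure lborel {x \<in> {p..p+l}. \<forall>j<J. \<bar>g (\<beta> j * x + \<theta> j) - c j\<bar> < \<delta>}
          \<le> (real m * (2 * \<epsilon> / T + 2 / B)) ^ J * (l + 2 * T / \<bar>\<beta> 0\<bar>)"
  using assms(7-)
proof (induction J arbitrary: \<beta> \<theta> c p l)
  case 0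
  have "{x \<in> {p..p+l}. \<forall>j<0. \<bar>g (\<beta> j * x + \<theta> j) - c j\<bar> < \<delta>} = {p..p+l}" by auto
  then show ?case using T 0 by simp
next
  case (Suc J)
  let ?\<kappa> = "real m * (2 * \<epsilon> / T + 2 / B)"
  define b where "b = \<beta> 0"
  have b: "b \<noteq> 0" "0 < \<bar>b\<bar>" using Suc.prems by (auto simp: b_def)
  obtain S where S: "finite S" "card S \<le> m" "{u \<in> {0..T}. \<bar>g u - c 0\<bar> < \<delta>} \<subseteq> (\<Union>s\<in>S. {s-\<epsilon>..s+\<epsilon>})"
    using cover by blast
  \<comment> \<open>\<open>lo\<close> is the left end of the image of \<open>{p..p+l}\<close> under
    \<open>x \<mapsto> b * x + \<theta> 0\<close>; the minimum covers both signs of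
    \<open>b\<close>. \<open>I\<close> numbers the periods which that image meets.\<close>
  define lo where "lo = min (b * p) (b * (p + l)) + \<theta> 0"
  define I where "I = {\<lfloor>lo / T\<rfloor>..\<lfloor>(lo + \<bar>b\<bar> * l) / T\<rfloor>}"
  define E where "E p' l' = {x \<in> {p'..p'+l'}. \<forall>j<J. \<bar>g (\<beta> (Suc j) * x + \<theta> (Suc j)) - c (Suc j)\<bar> < \<delta>}" for p' l'
  \<comment> \<open>Left end of the interval of radius \<open>\<epsilon> / \<bar>b\<bar>\<close>
    about the point that the affine map sends to \<open>s + of_int i * T\<close>.\<close>
  define q where "q i s = (s + of_int i * T - \<theta> 0) / b - \<epsilon> / \<bar>b\<bar>" for i :: int and s
  have meas: "E p' l' \<in> sets lborel" for p' l'
  proof -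
    have [measurable]: "g \<in> borel_measurable borel"
      using cont borel_measurable_continuous_onI by blast
    show ?thesis unfolding E_def by measurable
  qed
  have fm: "emeasure lborel (E p' l') \<noteq> \<infinity>" for p' l'
  proof -
    have "emeasure lborel (E p' l') \<le> emeasure lborel {p'..p'+l'}"
      by (intro emeasure_mono) (auto simp: E_def)
    then show ?thesis by (auto simp: emeasure_lborel_Icc_eq top_unique)
  qed
  have gT: "g (x - of_int i * T) = g x" for x and i :: int
  proof -
    interpret periodic_fun_simple g T by standard (use periodic in auto)
    show ?thesis by (rule minus_of_int)
  qed
  have sub: "{x \<in> {p..p+l}. \<forall>j<Suc J. \<bar>g (\<beta> j * x + \<theta> j) - c j\<bar> < \<delta>} \<subseteq>
      (\<Union>(i, s)\<in>I \<times> S. E (q i s) (2 * \<epsilon> / \<bar>b\<bar>))"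
  proof safe
    fix x assume x: "x \<in> {p..p+l}" "\<forall>j<Suc J. \<bar>g (\<beta> j * x + \<theta> j) - c j\<bar> < \<delta>"
    define u where "u = b * x + \<theta> 0"
    have u: "lo \<le> u" "u \<le> lo + \<bar>b\<bar> * l"
    proof -
      have "b * p \<le> b * x \<and> b * x \<le> b * (p + l) \<or> b * (p + l) \<le> b * x \<and> b * x \<le> b * p"
        using x(1) by (cases "b \<ge> 0") (simp_all add: mult_le_cancel_left)
      moreover have "b * (p + l) = b * p + \<bar>b\<bar> * l \<or> b * p = b * (p + l) + \<bar>b\<bar> * l"
        by (cases "b \<ge> 0") (auto simp: algebra_simps)
      moreover have "0 \<le> \<bar>b\<bar> * l" using Suc.prems by simp
      ultimately show "lo \<le> u" "u \<le> lo + \<bar>b\<bar> * l"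
        unfolding lo_def u_def by linarith+
    qed
    define i where "i = \<lfloor>u / T\<rfloor>"
    have i: "i \<in> I"
      unfolding I_def i_def using u T by (auto intro!: floor_mono divide_right_mono)
    have "u - of_int i * T \<in> {0..T}"
      using floor_divide_lower[OF T, of u] floor_divide_upper[OF T, of u]
      by (auto simp: i_def algebra_simps)
    moreover have "\<bar>g (u - of_int i * T) - c 0\<bar> < \<delta>"
      using x(2) gT by (auto simp: u_def b_def)
    ultimately obtain s where s: "s \<in> S" "\<bar>u - of_int i * T - s\<bar> \<le> \<epsilon>"
      using S(3) by fastforce
    have "x - (s + of_int i * T - \<theta> 0) / b = (u - of_int i * T - s) / b"
      using b by (simp add: u_def field_simps)
    then have "\<bar>x - (s + of_int i * T - \<theta> 0) / b\<bar> \<le> \<epsilon> / \<bar>b\<bar>"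
      using s(2) by (simp add: abs_divide divide_right_mono)
    then have "x \<in> {q i s..q i s + 2 * \<epsilon> / \<bar>b\<bar>}"
      unfolding q_def by (auto simp: abs_le_iff)
    then have "x \<in> E (q i s) (2 * \<epsilon> / \<bar>b\<bar>)"
      using x(2) by (auto simp: E_def)
    then show "x \<in> (\<Union>(i, s)\<in>I \<times> S. E (q i s) (2 * \<epsilon> / \<bar>b\<bar>))"
      using i s by blast
  qed
  have E: "measure lborel (E (q i s) (2 * \<epsilon> / \<bar>b\<bar>)) \<le> ?\<kappa> ^ J * ((2 * \<epsilon> + 2 * T / B) / \<bar>b\<bar>)" for i s
  proof -
    have "measure lborel (E (q i s) (2 * \<epsilon> / \<bar>b\<bar>)) \<le> ?\<kappa> ^ J * (2 * \<epsilon> / \<bar>b\<bar> + 2 * T / \<bar>\<beta> (Suc 0)\<bar>)"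
      unfolding E_def using Suc.IH[of "\<lambda>j. \<beta> (Suc j)"] Suc.prems \<open>0 < \<epsilon>\<close> by auto
    also have "2 * T / \<bar>\<beta> (Suc 0)\<bar> \<le> 2 * T / (B * \<bar>b\<bar>)"
      using Suc.prems(1)[of 1] Suc.prems(2)[of 0] T \<open>0 < B\<close> b
      by (intro divide_left_mono mult_pos_pos) (auto simp: b_def)
    finally show ?thesis
      using \<open>0 < B\<close> \<open>0 < \<epsilon>\<close> T b by (simp add: add_divide_distrib mult_left_mono)
  qed
  \<comment> \<open>The image has length \<open>\<bar>b\<bar> * l\<close>; rounding at its two ends
    adds at most 2 to the number of periods.\<close>
  have cI: "real (card I) \<le> \<bar>b\<bar> * l / T + 2"
  proof -
    have "0 \<le> \<bar>b\<bar> * l / T" using Suc.prems T by auto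
    moreover have "real_of_int \<lfloor>(lo + \<bar>b\<bar> * l) / T\<rfloor> \<le> (lo + \<bar>b\<bar> * l) / T" "lo / T < real_of_int \<lfloor>lo / T\<rfloor> + 1"
      by linarith+
    moreover have "(lo + \<bar>b\<bar> * l) / T = lo / T + \<bar>b\<bar> * l / T" by (simp add: add_divide_distrib)
    moreover have "\<lfloor>lo / T\<rfloor> \<le> \<lfloor>(lo + \<bar>b\<bar> * l) / T\<rfloor>"
      using Suc.prems T by (intro floor_mono divide_right_mono) auto
    then have "real (card I) = real_of_int \<lfloor>(lo + \<bar>b\<bar> * l) / T\<rfloor> - real_of_int \<lfloor>lo / T\<rfloor> + 1"
      by (simp add: I_def)
    ultimately show ?thesis by linarith
  qed
  have "measure lborel {x \<in> {p..p+l}. \<forall>j<Suc J. \<bar>g (\<beta> j * x + \<theta> j) - c j\<bar> < \<delta>}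
      \<le> measure lborel (\<Union>(i, s)\<in>I \<times> S. E (q i s) (2 * \<epsilon> / \<bar>b\<bar>))"
  proof (rule measure_mono_fmeasurable[OF sub])
    have [measurable]: "g \<in> borel_measurable borel"
      using cont borel_measurable_continuous_onI by blast
    show "{x \<in> {p..p+l}. \<forall>j<Suc J. \<bar>g (\<beta> j * x + \<theta> j) - c j\<bar> < \<delta>} \<in> sets lborel"
      by measurable
    show "(\<Union>(i, s)\<in>I \<times> S. E (q i s) (2 * \<epsilon> / \<bar>b\<bar>)) \<in> fmeasurable lborel"
      using S(1) meas fm by (intro fmeasurable.finite_UN) (auto simp: I_def fmeasurable_def less_top)
  qed
  also have "\<dots> \<le> (\<Sum>(i, s)\<in>I \<times> S. measure lborel (E (q i s) (2 * \<epsilon> / \<bar>b\<bar>)))"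
    using S(1) meas fm measure_UNION_le[of "I \<times> S" "\<lambda>(i, s). E (q i s) (2 * \<epsilon> / \<bar>b\<bar>)" lborel]
    by (auto simp: I_def case_prod_unfold)
  also have "\<dots> \<le> (\<Sum>(i, s)\<in>I \<times> S. ?\<kappa> ^ J * ((2 * \<epsilon> + 2 * T / B) / \<bar>b\<bar>))"
    using E by (intro sum_mono) auto
  also have "\<dots> = real (card I) * real (card S) * (?\<kappa> ^ J * ((2 * \<epsilon> + 2 * T / B) / \<bar>b\<bar>))"
    by (simp add: card_cartesian_product)
  also have "\<dots> \<le> (\<bar>b\<bar> * l / T + 2) * real m * (?\<kappa> ^ J * ((2 * \<epsilon> + 2 * T / B) / \<bar>b\<bar>))"
    using cI S(2) T \<open>0 < \<epsilon>\<close> \<open>0 < B\<close> Suc.prems by (intro mult_right_mono mult_mono) auto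
  also have "\<dots> = ?\<kappa> ^ Suc J * (l + 2 * T / \<bar>b\<bar>)"
    using T b \<open>0 < B\<close> by (simp add: field_simps)
  finally show ?case by (simp add: b_def)
qed

section \<open>Measures of bounded energy\<close>

lemma two_mult_le_sum_squares_ennreal:
  fixes x y :: ennreal
  shows "2 * (x * y) \<le> x\<^sup>2 + y\<^sup>2"
proof (cases x; cases y)
  fix u v :: real assume *: "x = ennreal u" "0 \<le> u" "y = ennreal v" "0 \<le> v"
  have "2 * (u * v) \<le> u\<^sup>2 + v\<^sup>2"
    using sum_squares_bound[of u v] by simp
  then have "ennreal (2 * (u * v)) \<le> ennreal (u\<^sup>2 + v\<^sup>2)" by (rule ennreal_leI)
  then show ?thesis using * by (simp add: ennreal_mult ennreal_power)
qed (auto simp: power2_eq_square ennreal_top_mult)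

text \<open>Writing the ball as an indicator of the difference \<open>u - s\<close> makes it a
  jointly measurable function of \<open>u\<close> and \<open>s\<close>, as Fubini requires.\<close>

lemma emeasure_abs_diff_less_eq_nn_integral:
  fixes \<mu> :: "real measure"
  assumes sets[measurable_cong]: "sets \<mu> = sets borel"
  shows "emeasure \<mu> {u. \<bar>u - s\<bar> < r} = (\<integral>\<^sup>+u. indicator {z. \<bar>z\<bar> < r} (u - s) \<partial>\<mu>)"
proof -
  have "(\<integral>\<^sup>+u. indicator {z. \<bar>z\<bar> < r} (u - s) \<partial>\<mu>) = (\<integral>\<^sup>+u. indicator {u. \<bar>u - s\<bar> < r} u \<partial>\<mu>)"
    by (intro nn_integral_cong) (auto simp: indicator_def)
  also have "\<dots> = emeasure \<mu> {u. \<bar>u - s\<bar> < r}"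
    by (rule nn_integral_indicator) measurable
  finally show ?thesis ..
qed

lemma borel_measurable_emeasure_abs_diff_less:
  fixes \<mu> :: "real measure"
  assumes "finite_measure \<mu>" and sets[measurable_cong]: "sets \<mu> = sets borel"
  shows "(\<lambda>s. emeasure \<mu> {u. \<bar>u - s\<bar> < r}) \<in> borel_measurable borel"
proof -
  interpret finite_measure \<mu> by fact
  show ?thesis
    unfolding emeasure_abs_diff_less_eq_nn_integral[OF sets] by measurable
qed

text \<open>The square of an integral against \<open>\<mu>\<close> is a double integral, and Fubini
  moves the integral over \<open>s\<close> inside. What remains is the overlap of the intervals of
  radius \<open>r\<close> about \<open>u\<close> and \<open>v\<close>: its length is at most
  \<open>2 * r\<close>, and zero unless \<open>\<bar>u - v\<bar> < 2 * r\<close>. This is how the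
  energy at the doubled scale arises.\<close>

lemma nn_integral_square_local_average_le:
  fixes \<mu> :: "real measure"
  assumes "finite_measure \<mu>" and sets[measurable_cong]: "sets \<mu> = sets borel" and r: "0 < r"
  shows "(\<integral>\<^sup>+s. (emeasure \<mu> {u. \<bar>u - s\<bar> < r} / ennreal (2 * r))\<^sup>2 \<partial>lborel)
       \<le> (\<integral>\<^sup>+u. emeasure \<mu> {v. \<bar>u - v\<bar> < 2 * r} \<partial>\<mu>) / ennreal (2 * r)"
proof -
  interpret finite_measure \<mu> by fact
  interpret P: pair_sigma_finite \<mu> lborel ..
  let ?I = "\<lambda>u s. indicator {z. \<bar>z\<bar> < r} (u - s) :: ennreal"
  have H: "emeasure \<mu> {u. \<bar>u - s\<bar> < r} = (\<integral>\<^sup>+u. ?I u s \<partial>\<mu>)" for s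
    by (rule emeasure_abs_diff_less_eq_nn_integral[OF sets])
  have sq: "(\<integral>\<^sup>+u. ?I u s \<partial>\<mu>)\<^sup>2 = (\<integral>\<^sup>+u. (\<integral>\<^sup>+v. ?I u s * ?I v s \<partial>\<mu>) \<partial>\<mu>)" for s
    by (simp add: power2_eq_square nn_integral_cmult nn_integral_multc)
  have "(\<integral>\<^sup>+s. (\<integral>\<^sup>+u. ?I u s \<partial>\<mu>)\<^sup>2 \<partial>lborel) = (\<integral>\<^sup>+s. (\<integral>\<^sup>+u. (\<integral>\<^sup>+v. ?I u s * ?I v s \<partial>\<mu>) \<partial>\<mu>) \<partial>lborel)"
    by (simp add: sq)
  also have "\<dots> = (\<integral>\<^sup>+u. (\<integral>\<^sup>+s. (\<integral>\<^sup>+v. ?I u s * ?I v s \<partial>\<mu>) \<partial>lborel) \<partial>\<mu>)"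
    by (rule P.Fubini') measurable
  also have "\<dots> = (\<integral>\<^sup>+u. (\<integral>\<^sup>+v. (\<integral>\<^sup>+s. ?I u s * ?I v s \<partial>lborel) \<partial>\<mu>) \<partial>\<mu>)"
    by (intro nn_integral_cong P.Fubini') measurable
  also have "\<dots> \<le> (\<integral>\<^sup>+u. (\<integral>\<^sup>+v. ennreal (2 * r) * indicator {v. \<bar>u - v\<bar> < 2 * r} v \<partial>\<mu>) \<partial>\<mu>)"
  proof (intro nn_integral_mono)
    fix u v :: real
    have "(\<integral>\<^sup>+s. ?I u s * ?I v s \<partial>lborel)
        \<le> (\<integral>\<^sup>+s. indicator {u-r..u+r} s * indicator {v. \<bar>u - v\<bar> < 2 * r} v \<partial>lborel)"
      by (intro nn_integral_mono) (auto simp: indicator_def)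
    also have "\<dots> = ennreal (2 * r) * indicator {v. \<bar>u - v\<bar> < 2 * r} v"
      using r by (simp add: nn_integral_multc)
    finally show "(\<integral>\<^sup>+s. ?I u s * ?I v s \<partial>lborel) \<le> ennreal (2 * r) * indicator {v. \<bar>u - v\<bar> < 2 * r} v" .
  qed
  also have "\<dots> = ennreal (2 * r) * (\<integral>\<^sup>+u. emeasure \<mu> {v. \<bar>u - v\<bar> < 2 * r} \<partial>\<mu>)"
    using borel_measurable_emeasure_abs_diff_less[OF assms(1,2), of "2 * r"]
    by (simp add: nn_integral_cmult abs_minus_commute cong: measurable_cong_sets)
  finally have *: "(\<integral>\<^sup>+s. (\<integral>\<^sup>+u. ?I u s \<partial>\<mu>)\<^sup>2 \<partial>lborel) \<le>
    ennreal (2 * r) * (\<integral>\<^sup>+u. emeasure \<mu> {v. \<bar>u - v\<bar> < 2 * r} \<partial>\<mu>)" .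
  have "(\<integral>\<^sup>+s. (emeasure \<mu> {u. \<bar>u - s\<bar> < r} / ennreal (2 * r))\<^sup>2 \<partial>lborel)
      = (\<integral>\<^sup>+s. (\<integral>\<^sup>+u. ?I u s \<partial>\<mu>)\<^sup>2 \<partial>lborel) / (ennreal (2 * r))\<^sup>2"
    unfolding H by (simp add: divide_ennreal_def nn_integral_multc power_mult_distrib ennreal_inverse_power)
  also have "\<dots> \<le> ennreal (2 * r) * (\<integral>\<^sup>+u. emeasure \<mu> {v. \<bar>u - v\<bar> < 2 * r} \<partial>\<mu>) / (ennreal (2 * r))\<^sup>2"
    by (intro divide_right_mono_ennreal *)
  also have "\<dots> = (\<integral>\<^sup>+u. emeasure \<mu> {v. \<bar>u - v\<bar> < 2 * r} \<partial>\<mu>) / ennreal (2 * r)"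
    using r by (simp add: power2_eq_square divide_mult_eq mult.commute[of "ennreal (2 * r)" "integral\<^sup>N \<mu> _"])
  finally show ?thesis .
qed


text \<open>Near \<open>u\<close> the function exceeds \<open>\<phi> u - e\<close>, so its averages
  over short intervals are at least that. Lower semicontinuity, spelled out in \<open>lsc\<close>,
  admits both indicators of open sets and continuous functions as test functions.\<close>

lemma lsc_le_liminf_local_average:
  fixes \<phi> :: "real \<Rightarrow> real"
  assumes [measurable]: "\<phi> \<in> borel_measurable borel"
    and lsc: "\<And>e. 0 < e \<Longrightarrow> \<forall>\<^sub>F x in nhds u. \<phi> u - e < \<phi> x"
    and r: "\<And>k. 0 < r k" "r \<longlonglongrightarrow> 0"
  shows "ennreal (\<phi> u) \<le> liminf (\<lambda>k. (\<integral>\<^sup>+s. indicator {s. \<bar>u - s\<bar> < r k} s * ennreal (\<phi> s) \<partial>lborel) / ennreal (2 * r k))"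
    (is "_ \<le> liminf ?avg")
proof (rule ennreal_le_epsilon)
  fix e :: real assume e: "0 < e"
  obtain d where d: "0 < d" "\<And>x. dist x u < d \<Longrightarrow> \<phi> u - e < \<phi> x"
    using lsc[OF e] unfolding eventually_nhds_metric by blast
  have "\<forall>\<^sub>F k in sequentially. r k < d"
    using r(2) d(1) by (rule order_tendstoD)
  then have "\<forall>\<^sub>F k in sequentially. ennreal (\<phi> u - e) \<le> ?avg k"
  proof eventually_elim
    case (elim k)
    have eq: "{s. \<bar>u - s\<bar> < r k} = {u - r k<..<u + r k}" by auto
    have "ennreal (\<phi> u - e) = (\<integral>\<^sup>+s. indicator {s. \<bar>u - s\<bar> < r k} s * ennreal (\<phi> u - e) \<partial>lborel) / ennreal (2 * r k)"
      using r(1)[of k] unfolding eq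
      by (simp add: nn_integral_multc mult.commute[of "ennreal (2 * r k)"] ennreal_mult_divide_eq)
    also have "\<dots> \<le> ?avg k"
    proof (intro divide_right_mono_ennreal nn_integral_mono)
      fix s
      have "\<phi> u - e \<le> \<phi> s" if "\<bar>u - s\<bar> < r k"
        using elim d(2)[of s] that by (simp add: dist_real_def abs_minus_commute)
      then show "indicator {s. \<bar>u - s\<bar> < r k} s * ennreal (\<phi> u - e)
          \<le> indicator {s. \<bar>u - s\<bar> < r k} s * ennreal (\<phi> s)"
        by (auto simp: indicator_def intro: ennreal_leI)
    qed
    finally show ?case .
  qed
  then have "ennreal (\<phi> u - e) \<le> liminf ?avg" by (rule Liminf_bounded)
  moreover have "ennreal (\<phi> u) \<le> ennreal (\<phi> u - e) + ennreal e"
    using e by (cases "\<phi> u - e \<ge> 0") (auto simp: ennreal_plus[symmetric] ennreal_neg intro: ennreal_leI simp del: ennreal_plus)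
  ultimately show "ennreal (\<phi> u) \<le> liminf ?avg + ennreal e"
    by (meson add_mono_thms_linordered_semiring(3) order_trans)
qed

text \<open>
  For a fixed kernel width this is \<open>2 \<phi> h \<le> h\<^sup>2 + \<phi>\<^sup>2\<close> integrated, \<open>h\<close> being the local average of \<open>\<mu>\<close>.
  It replaces the inequality \<open>\<integral> \<phi> d\<mu> \<le> \<parallel>h\<parallel>\<^sub>2 \<parallel>\<phi>\<parallel>\<^sub>2\<close> and avoids square roots.
\<close>
lemma nn_integral_lsc_le_energy:
  fixes \<mu> :: "real measure" and \<phi> :: "real \<Rightarrow> real"
  assumes "finite_measure \<mu>" and sets[measurable_cong]: "sets \<mu> = sets borel"
    and r: "\<And>k. 0 < r k" "r \<longlonglongrightarrow> 0"
    and \<phi>[measurable]: "\<phi> \<in> borel_measurable borel"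
    and lsc: "\<And>u e. 0 < e \<Longrightarrow> \<forall>\<^sub>F x in nhds u. \<phi> u - e < \<phi> x"
  shows "2 * (\<integral>\<^sup>+u. ennreal (\<phi> u) \<partial>\<mu>) \<le>
    liminf (\<lambda>k. (\<integral>\<^sup>+u. emeasure \<mu> {v. \<bar>u - v\<bar> < 2 * r k} \<partial>\<mu>) / ennreal (2 * r k))
      + (\<integral>\<^sup>+u. (ennreal (\<phi> u))\<^sup>2 \<partial>lborel)"
    (is "_ \<le> liminf ?en + ?Q")
proof -
  interpret finite_measure \<mu> by fact
  interpret P: pair_sigma_finite \<mu> lborel ..
  define H where "H k s = emeasure \<mu> {u. \<bar>u - s\<bar> < r k} / ennreal (2 * r k)" for k s
  have [measurable]: "(\<lambda>s. emeasure \<mu> {u. \<bar>u - s\<bar> < r k}) \<in> borel_measurable borel" for k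
    by (rule borel_measurable_emeasure_abs_diff_less) fact+
  have [measurable]: "H k \<in> borel_measurable borel" for k
    unfolding H_def by measurable
  let ?avg = "\<lambda>k u. (\<integral>\<^sup>+s. indicator {s. \<bar>u - s\<bar> < r k} s * ennreal (\<phi> s) \<partial>lborel) / ennreal (2 * r k)"
  have swap: "(\<integral>\<^sup>+u. ?avg k u \<partial>\<mu>) = (\<integral>\<^sup>+s. ennreal (\<phi> s) * H k s \<partial>lborel)" for k
  proof -
    let ?I = "\<lambda>u s. indicator {z. \<bar>z\<bar> < r k} (u - s) :: ennreal"
    have I: "indicator {s. \<bar>u - s\<bar> < r k} s = ?I u s" "indicator {u. \<bar>u - s\<bar> < r k} u = ?I u s" for u s
      by (auto simp: indicator_def)
    have "(\<integral>\<^sup>+u. ?avg k u \<partial>\<mu>) = (\<integral>\<^sup>+u. (\<integral>\<^sup>+s. ?I u s * ennreal (\<phi> s) \<partial>lborel) \<partial>\<mu>) / ennreal (2 * r k)"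
      unfolding I by (simp add: divide_ennreal_def nn_integral_multc)
    also have "(\<integral>\<^sup>+u. (\<integral>\<^sup>+s. ?I u s * ennreal (\<phi> s) \<partial>lborel) \<partial>\<mu>) =
        (\<integral>\<^sup>+s. (\<integral>\<^sup>+u. ?I u s * ennreal (\<phi> s) \<partial>\<mu>) \<partial>lborel)"
      by (rule P.Fubini'[symmetric]) measurable
    also have "\<dots> = (\<integral>\<^sup>+s. emeasure \<mu> {u. \<bar>u - s\<bar> < r k} * ennreal (\<phi> s) \<partial>lborel)"
      by (intro nn_integral_cong) (simp add: nn_integral_multc emeasure_abs_diff_less_eq_nn_integral[OF sets])
    also have "\<dots> / ennreal (2 * r k) = (\<integral>\<^sup>+s. ennreal (\<phi> s) * H k s \<partial>lborel)"
      unfolding H_def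
      by (subst nn_integral_divide[symmetric]) (auto simp: ennreal_times_divide mult.commute)
    finally show ?thesis .
  qed
  have [measurable]: "?avg k \<in> borel_measurable borel" for k
  proof -
    have I: "indicator {s. \<bar>u - s\<bar> < r k} s = (indicator {z. \<bar>z\<bar> < r k} (u - s) :: ennreal)" for u s
      by (auto simp: indicator_def)
    show ?thesis unfolding I by measurable
  qed
  have "(\<integral>\<^sup>+u. ennreal (\<phi> u) \<partial>\<mu>) \<le> (\<integral>\<^sup>+u. liminf (\<lambda>k. ?avg k u) \<partial>\<mu>)"
    by (intro nn_integral_mono lsc_le_liminf_local_average lsc r) auto
  also have "\<dots> \<le> liminf (\<lambda>k. \<integral>\<^sup>+u. ?avg k u \<partial>\<mu>)"
    by (intro nn_integral_liminf) measurable
  also have "\<dots> = liminf (\<lambda>k. \<integral>\<^sup>+s. ennreal (\<phi> s) * H k s \<partial>lborel)"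
    by (simp add: swap)
  finally have "2 * (\<integral>\<^sup>+u. ennreal (\<phi> u) \<partial>\<mu>) \<le> 2 * liminf (\<lambda>k. \<integral>\<^sup>+s. ennreal (\<phi> s) * H k s \<partial>lborel)"
    by (rule mult_left_mono) simp
  also have "\<dots> = liminf (\<lambda>k. 2 * (\<integral>\<^sup>+s. ennreal (\<phi> s) * H k s \<partial>lborel))"
    by (intro Liminf_compose_continuous_mono[symmetric, where f="\<lambda>x. 2 * x"] monoI mult_left_mono
        ennreal_continuous_on_cmult continuous_on_id) auto
  also have "\<dots> \<le> liminf (\<lambda>k. ?en k + ?Q)"
  proof (intro Liminf_mono always_eventually allI)
    fix k
    have "2 * (\<integral>\<^sup>+s. ennreal (\<phi> s) * H k s \<partial>lborel) = (\<integral>\<^sup>+s. 2 * (ennreal (\<phi> s) * H k s) \<partial>lborel)"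
      by (simp add: nn_integral_cmult)
    also have "\<dots> \<le> (\<integral>\<^sup>+s. (H k s)\<^sup>2 + (ennreal (\<phi> s))\<^sup>2 \<partial>lborel)"
      by (intro nn_integral_mono) (metis two_mult_le_sum_squares_ennreal add.commute)
    also have "\<dots> = (\<integral>\<^sup>+s. (H k s)\<^sup>2 \<partial>lborel) + ?Q"
      by (simp add: nn_integral_add)
    also have "(\<integral>\<^sup>+s. (H k s)\<^sup>2 \<partial>lborel) \<le> ?en k"
      unfolding H_def by (rule nn_integral_square_local_average_le) (use assms in auto)
    finally show "2 * (\<integral>\<^sup>+s. ennreal (\<phi> s) * H k s \<partial>lborel) \<le> ?en k + ?Q" by simp
  qed
  also have "\<dots> = liminf ?en + ?Q"
    by (simp add: Liminf_add_const)
  finally show ?thesis .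
qed

text \<open>The inequality \<open>bound\<close> is tested twice. Large multiples of indicators of
  small open sets around a null set give absolute continuity; truncations of the resulting
  Radon-Nikodym density, reached through continuous functions, then bound its square integral by
  \<open>C\<close>.\<close>

lemma abs_cont_L2_densityI_energy:
  fixes \<mu> :: "real measure" and r :: "nat \<Rightarrow> real"
  assumes fin: "finite_measure \<mu>" and sets[measurable_cong]: "sets \<mu> = sets borel"
    and r: "\<And>k. 0 < r k" "r \<longlonglongrightarrow> 0"
    and energy: "liminf (\<lambda>k. (\<integral>\<^sup>+u. emeasure \<mu> {v. \<bar>u - v\<bar> < 2 * r k} \<partial>\<mu>) / ennreal (2 * r k)) < \<infinity>"
  shows "abs_cont_L2_density \<mu>"
proof -
  interpret finite_measure \<mu> by fact
  obtain C where C: "0 \<le> C"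
    "liminf (\<lambda>k. (\<integral>\<^sup>+u. emeasure \<mu> {v. \<bar>u - v\<bar> < 2 * r k} \<partial>\<mu>) / ennreal (2 * r k)) = ennreal C"
    using energy less_top_ennreal by auto
  note bound = nn_integral_lsc_le_energy[OF fin sets r, unfolded C(2)]
  have "N \<in> null_sets \<mu>" if N: "N \<in> null_sets lborel" for N
  proof (rule ccontr)
    assume "N \<notin> null_sets \<mu>"
    with N have "measure \<mu> N \<noteq> 0"
      by (auto simp: null_sets_def sets emeasure_eq_measure)
    then have m: "0 < measure \<mu> N" by (simp add: zero_less_measure_iff)
    \<comment> \<open>With this \<open>t\<close> and an open \<open>U\<close> of length at most
      \<open>1 / t\<^sup>2\<close>, \<open>bound\<close> gives
      \<open>2 * (C + 1) = 2 * t * measure \<mu> N \<le> C + 1\<close>, which is absurd.\<close>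
    define t where "t = (C + 1) / measure \<mu> N"
    have t: "0 < t" using m C by (simp add: t_def)
    have Nb: "N \<in> sets borel" "emeasure lborel N = 0" using N by auto
    obtain U where U: "open U" "N \<subseteq> U" "emeasure lborel (U - N) < ennreal (1 / t\<^sup>2)"
      using outer_regular_lborel[OF Nb(1), of "1 / t\<^sup>2"] t by (metis zero_less_divide_1_iff zero_less_power)
    have [measurable]: "U \<in> sets borel" using U by simp
    define \<phi> where "\<phi> x = t * indicator U x" for x
    have [measurable]: "\<phi> \<in> borel_measurable borel" unfolding \<phi>_def by measurable
    have lsc: "\<forall>\<^sub>F x in nhds u. \<phi> u - e < \<phi> x" if "0 < e" for u e
    proof (cases "u \<in> U")
      case True
      then have "\<forall>\<^sub>F x in nhds u. x \<in> U" using U(1) by (rule eventually_nhds_in_open[rotated])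
      then show ?thesis by eventually_elim (use True that in \<open>simp add: \<phi>_def\<close>)
    next
      case False
      then show ?thesis using t that by (intro always_eventually) (auto simp: \<phi>_def indicator_def)
    qed
    have "emeasure lborel U \<le> emeasure lborel (U - N) + emeasure lborel N"
      using U(2) Nb(1) emeasure_subadditive[of "U - N" lborel N] by (simp add: Un_absorb2)
    then have leU: "emeasure lborel U \<le> ennreal (1 / t\<^sup>2)" using U(3) Nb(2) by simp
    have "ennreal (2 * t * measure \<mu> N) \<le> 2 * (\<integral>\<^sup>+u. ennreal (\<phi> u) \<partial>\<mu>)"
    proof -
      have "(\<integral>\<^sup>+u. ennreal (\<phi> u) \<partial>\<mu>) = (\<integral>\<^sup>+u. ennreal t * indicator U u \<partial>\<mu>)"
        by (intro nn_integral_cong) (auto simp: \<phi>_def indicator_def)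
      also have "\<dots> = ennreal (t * measure \<mu> U)"
        using t by (simp add: nn_integral_cmult emeasure_eq_measure ennreal_mult)
      also have "\<dots> \<ge> ennreal (t * measure \<mu> N)"
        using t U(2) by (intro ennreal_leI mult_left_mono finite_measure_mono) (auto simp: sets)
      finally show ?thesis
        using t by (simp add: ennreal_mult mult.assoc mult_left_mono)
    qed
    also have "\<dots> \<le> ennreal C + (\<integral>\<^sup>+u. (ennreal (\<phi> u))\<^sup>2 \<partial>lborel)"
      by (rule bound) (use lsc in auto)
    also have "(\<integral>\<^sup>+u. (ennreal (\<phi> u))\<^sup>2 \<partial>lborel) = (\<integral>\<^sup>+u. ennreal (t\<^sup>2) * indicator U u \<partial>lborel)"
      using t by (intro nn_integral_cong) (auto simp: \<phi>_def indicator_def ennreal_power)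
    also have "\<dots> = ennreal (t\<^sup>2) * emeasure lborel U"
      by (simp add: nn_integral_cmult)
    also have "\<dots> \<le> ennreal (t\<^sup>2) * ennreal (1 / t\<^sup>2)"
      using leU by (rule mult_left_mono) simp
    also have "\<dots> = 1" using t by (simp add: ennreal_mult[symmetric])
    finally have "ennreal (2 * t * measure \<mu> N) \<le> ennreal (C + 1)" using C by simp
    then have "2 * t * measure \<mu> N \<le> C + 1" using C by (subst (asm) ennreal_le_iff) auto
    then show False using m C by (simp add: t_def)
  qed
  then have ac: "absolutely_continuous lborel \<mu>"
    by (auto simp: absolutely_continuous_def)
  obtain D where D[measurable]: "D \<in> borel_measurable lborel"
    and RN: "AE x in lborel. RN_deriv lborel \<mu> x = ennreal (D x)" and D0: "\<And>x. 0 \<le> D x"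
    using sigma_finite_measure.real_RN_deriv[OF sigma_finite_lborel fin ac] sets by (metis sets_lborel)
  have dens: "\<mu> = density lborel (\<lambda>x. ennreal (D x))"
  proof -
    have "\<mu> = density lborel (RN_deriv lborel \<mu>)"
      using sigma_finite_measure.density_RN_deriv[OF sigma_finite_lborel ac] sets by simp
    also have "\<dots> = density lborel (\<lambda>x. ennreal (D x))"
      using RN by (intro density_cong) auto
    finally show ?thesis .
  qed
  \<comment> \<open>\<open>D\<close> need not be lower semicontinuous, so \<open>bound\<close>
    cannot be applied to it directly; off a negligible set it is a limit of continuous
    functions.\<close>
  have "D measurable_on UNIV"
    by (rule lebesgue_measurable_imp_measurable_on) (auto intro: measurable_completion D)
  then obtain N G where N: "negligible N" and G: "\<And>n. continuous_on UNIV (G n)"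
    and lim: "\<And>x. x \<notin> N \<Longrightarrow> (\<lambda>n. G n x) \<longlonglongrightarrow> D x"
    unfolding measurable_on_def by auto
  have AE_lim: "AE x in lborel. (\<lambda>n. G n x) \<longlonglongrightarrow> D x"
  proof -
    have "AE x in lebesgue. x \<notin> N"
      using N by (intro AE_not_in) (simp add: negligible_iff_null_sets)
    then have "AE x in lborel. x \<notin> N" by (simp add: AE_completion_iff)
    then show ?thesis by eventually_elim (rule lim)
  qed
  then have AE_lim': "AE x in \<mu>. (\<lambda>n. G n x) \<longlonglongrightarrow> D x"
    using ac sets by (intro absolutely_continuous_AE[of \<mu> lborel]) auto
  \<comment> \<open>Testing \<open>bound\<close> with continuous approximations of a truncation \<open>\<phi> \<le> D\<close> of \<open>D\<close> itself yields
    \<open>2 \<integral> \<phi>\<^sup>2 \<le> 2 \<integral> \<phi> D \<le> C + \<integral> \<phi>\<^sup>2\<close>, so \<open>\<integral> \<phi>\<^sup>2 \<le> C\<close>.\<close>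
  define cut :: "nat \<Rightarrow> real \<Rightarrow> real" where "cut K x = max 0 (min 1 (real K + 1 - \<bar>x\<bar>))" for K x
  \<comment> \<open>\<open>cut K\<close> is continuous, 1 on [-K, K] and 0 outside [-(K+1), K+1], so
    \<open>tr\<close> preserves continuity and is dominated by a multiple of the indicator of a
    bounded interval. The maximum with 0 matters for the \<open>G n\<close>, which may be
    negative.\<close>
  define tr :: "nat \<Rightarrow> real \<Rightarrow> real \<Rightarrow> real" where "tr K y x = max 0 (min y (real K)) * cut K x" for K y x
  have cut: "0 \<le> cut K x" "cut K x \<le> 1" "cut K x \<le> indicator {-(real K+1)..real K+1} x" for K x
    by (auto simp: cut_def indicator_def)
  have tr0: "0 \<le> tr K y x" for K y x using cut by (simp add: tr_def)
  have tr_le: "tr K y x \<le> real K * indicator {-(real K+1)..real K+1} x" for K y x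
    unfolding tr_def using cut[of K x] by (intro mult_mono) auto
  have tr_D: "tr K (D x) x \<le> D x" for K x
    using mult_mono[of "max 0 (min (D x) (real K))" "D x" "cut K x" 1] D0[of x] cut[of K x] by (simp add: tr_def)
  have [measurable]: "(\<lambda>x. tr K (D x) x) \<in> borel_measurable borel" for K
    unfolding tr_def cut_def using D by measurable
  have ctr: "continuous_on UNIV (\<lambda>x. tr K (G n x) x)" for K n
    unfolding tr_def cut_def by (intro continuous_intros G)
  have [measurable]: "(\<lambda>x. tr K (G n x) x) \<in> borel_measurable borel" for K n
    using ctr by (rule borel_measurable_continuous_onI)
  have tr_lim: "(\<lambda>n. tr K (y n) x) \<longlonglongrightarrow> tr K z x" if "y \<longlonglongrightarrow> z" for y z K x
    unfolding tr_def by (intro tendsto_intros that)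
  have main: "(\<integral>\<^sup>+x. (ennreal (tr K (D x) x))\<^sup>2 \<partial>lborel) \<le> ennreal C" for K
  proof -
    let ?w = "\<lambda>x. ennreal (real K) * indicator {-(real K+1)..real K+1} x"
    let ?X = "\<integral>\<^sup>+x. (ennreal (tr K (D x) x))\<^sup>2 \<partial>lborel"
    have le: "ennreal (tr K y x) \<le> ?w x" for y x
      using ennreal_leI[OF tr_le[of K y x]] by (simp add: ennreal_mult ennreal_indicator)
    have le2: "(ennreal (tr K y x))\<^sup>2 \<le> ennreal ((real K)\<^sup>2) * indicator {-(real K+1)..real K+1} x" for y x
      using power_mono[OF le[of y x], of 2]
      by (auto simp: indicator_def power_mult_distrib ennreal_power split: if_splits)
    have lim1: "(\<lambda>n. \<integral>\<^sup>+x. ennreal (tr K (G n x) x) \<partial>\<mu>) \<longlonglongrightarrow> (\<integral>\<^sup>+x. ennreal (tr K (D x) x) \<partial>\<mu>)"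
    proof (rule nn_integral_dominated_convergence[where w="?w"])
      show "AE x in \<mu>. (\<lambda>n. ennreal (tr K (G n x) x)) \<longlonglongrightarrow> ennreal (tr K (D x) x)"
        using AE_lim' by eventually_elim (intro tendsto_ennrealI tr_lim)
      show "(\<integral>\<^sup>+x. ?w x \<partial>\<mu>) < \<infinity>"
        by (simp add: nn_integral_cmult ennreal_mult_less_top emeasure_eq_measure sets)
    qed (use le in \<open>auto cong: measurable_cong_sets\<close>)
    have lim2: "(\<lambda>n. \<integral>\<^sup>+x. (ennreal (tr K (G n x) x))\<^sup>2 \<partial>lborel) \<longlonglongrightarrow> ?X"
    proof (rule nn_integral_dominated_convergence[where w="\<lambda>x. ennreal ((real K)\<^sup>2) * indicator {-(real K+1)..real K+1} x"])
      show "AE x in lborel. (\<lambda>n. (ennreal (tr K (G n x) x))\<^sup>2) \<longlonglongrightarrow> (ennreal (tr K (D x) x))\<^sup>2"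
        using AE_lim
      proof eventually_elim
        case (elim x)
        then have "(\<lambda>n. ennreal ((tr K (G n x) x)\<^sup>2)) \<longlonglongrightarrow> ennreal ((tr K (D x) x)\<^sup>2)"
          by (intro tendsto_ennrealI tendsto_power tr_lim)
        then show ?case by (simp add: ennreal_power tr0)
      qed
      show "(\<integral>\<^sup>+x. ennreal ((real K)\<^sup>2) * indicator {-(real K+1)..real K+1} x \<partial>lborel) < \<infinity>"
        by (simp add: nn_integral_cmult ennreal_mult_less_top)
    qed (use le2 in auto)
    \<comment> \<open>Finiteness allows \<open>?X\<close> to be cancelled from
      \<open>?X + ?X \<le> ennreal C + ?X\<close>.\<close>
    have Xfin: "?X < \<infinity>"
    proof -
      have "?X \<le> (\<integral>\<^sup>+x. ennreal ((real K)\<^sup>2) * indicator {-(real K+1)..real K+1} x \<partial>lborel)"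
        by (intro nn_integral_mono le2)
      also have "\<dots> < \<infinity>" by (simp add: nn_integral_cmult ennreal_mult_less_top)
      finally show ?thesis .
    qed
    have "2 * ?X \<le> 2 * (\<integral>\<^sup>+x. ennreal (tr K (D x) x) \<partial>\<mu>)"
    proof (intro mult_left_mono)
      have "(\<integral>\<^sup>+x. ennreal (tr K (D x) x) \<partial>\<mu>) = (\<integral>\<^sup>+x. ennreal (D x) * ennreal (tr K (D x) x) \<partial>lborel)"
        by (subst dens, subst nn_integral_density) auto
      also have "\<dots> \<ge> ?X"
        unfolding power2_eq_square by (intro nn_integral_mono mult_right_mono ennreal_leI tr_D) auto
      finally show "?X \<le> (\<integral>\<^sup>+x. ennreal (tr K (D x) x) \<partial>\<mu>)" .
    qed simp
    also have "2 * (\<integral>\<^sup>+x. ennreal (tr K (D x) x) \<partial>\<mu>) \<le> ennreal C + ?X"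
    proof (rule tendsto_le[OF sequentially_bot])
      show "(\<lambda>n. 2 * (\<integral>\<^sup>+x. ennreal (tr K (G n x) x) \<partial>\<mu>)) \<longlonglongrightarrow> 2 * (\<integral>\<^sup>+x. ennreal (tr K (D x) x) \<partial>\<mu>)"
        by (intro ennreal_tendsto_cmult lim1) simp
      show "(\<lambda>n. ennreal C + (\<integral>\<^sup>+x. (ennreal (tr K (G n x) x))\<^sup>2 \<partial>lborel)) \<longlonglongrightarrow> ennreal C + ?X"
        by (intro tendsto_add tendsto_const lim2)
      show "\<forall>\<^sub>F n in sequentially. 2 * (\<integral>\<^sup>+x. ennreal (tr K (G n x) x) \<partial>\<mu>)
              \<le> ennreal C + (\<integral>\<^sup>+x. (ennreal (tr K (G n x) x))\<^sup>2 \<partial>lborel)"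
      proof (rule always_eventually, rule allI, rule bound)
        fix n u and e :: real assume "0 < e"
        have "isCont (\<lambda>x. tr K (G n x) x) u"
          using ctr by (simp add: continuous_on_eq_continuous_at)
        then have "((\<lambda>x. tr K (G n x) x) \<longlongrightarrow> tr K (G n u) u) (nhds u)"
          using tendsto_at_iff_tendsto_nhds[of "\<lambda>x. tr K (G n x) x" u] by (simp add: isCont_def)
        then show "\<forall>\<^sub>F x in nhds u. tr K (G n u) u - e < tr K (G n x) x"
          by (rule order_tendstoD) (use \<open>0 < e\<close> in simp)
      qed simp
    qed
    finally have "?X + ?X \<le> ennreal C + ?X" by (simp add: mult_2)
    then show ?thesis using Xfin by (auto simp: ennreal_add_left_cancel_le add.commute)
  qed
  \<comment> \<open>The truncation equals \<open>D x\<close> as soon as \<open>K\<close> is at least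
    \<open>D x\<close> and \<open>\<bar>x\<bar>\<close>, so Fatou carries the uniform bound
    \<open>C\<close> over to \<open>D\<close>.\<close>
  have "(\<integral>\<^sup>+x. (ennreal (D x))\<^sup>2 \<partial>lborel) \<le> (\<integral>\<^sup>+x. liminf (\<lambda>K. (ennreal (tr K (D x) x))\<^sup>2) \<partial>lborel)"
  proof (intro nn_integral_mono Liminf_bounded)
    fix x
    obtain k :: nat where k: "max (D x) \<bar>x\<bar> \<le> real k" using real_arch_simple by blast
    show "\<forall>\<^sub>F K in sequentially. (ennreal (D x))\<^sup>2 \<le> (ennreal (tr K (D x) x))\<^sup>2"
      using eventually_ge_at_top[of k]
    proof eventually_elim
      case (elim K)
      then have "D x \<le> real K" "\<bar>x\<bar> \<le> real K" using k by (auto intro: order_trans)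
      then have "tr K (D x) x = D x" using D0[of x] by (simp add: tr_def cut_def)
      then show ?case by simp
    qed
  qed
  also have "\<dots> \<le> liminf (\<lambda>K. \<integral>\<^sup>+x. (ennreal (tr K (D x) x))\<^sup>2 \<partial>lborel)"
    by (intro nn_integral_liminf) auto
  also have "\<dots> \<le> ennreal C"
    using main by (intro Liminf_le) (auto intro: always_eventually)
  also have "\<dots> < \<infinity>" by simp
  finally have "(\<integral>\<^sup>+x. (ennreal (D x))\<^sup>2 \<partial>lborel) < \<infinity>" .
  then have "integrable lborel (\<lambda>x. (D x)\<^sup>2)"
    using D0 by (intro integrableI_nonneg) (auto simp: ennreal_power)
  then show ?thesis
    unfolding abs_cont_L2_density_def using ac D D0 dens by (intro conjI exI[of _ D]) auto
qed

section \<open>Small ball probabilities of random series\<close>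

text \<open>For a fixed value \<open>y\<close> of \<open>R\<close> the event confines
  \<open>X\<close> to an interval of length \<open>2 * \<rho> / \<bar>d\<bar>\<close>, and the
  density of \<open>X\<close> is at most \<open>1 / (2 * \<alpha>)\<close>. Independence makes the
  joint law a product, so the bound can be integrated over \<open>y\<close>.\<close>

lemma (in prob_space) uniform_affine_small_ball:
  fixes X R :: "'a \<Rightarrow> real"
  assumes ind: "indep_var borel X borel R"
    and X: "distr M borel X = uniform_measure lborel {-\<alpha><..<\<alpha>}"
    and "0 < \<alpha>" "d \<noteq> 0" "0 < \<rho>"
  shows "emeasure M {\<omega> \<in> space M. \<bar>X \<omega> * d + R \<omega>\<bar> < \<rho>} \<le> ennreal (\<rho> / (\<alpha> * \<bar>d\<bar>))"
proof -
  have [measurable]: "random_variable borel X" "random_variable borel R"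
    and joint: "distr M borel X \<Otimes>\<^sub>M distr M borel R = distr M (borel \<Otimes>\<^sub>M borel) (\<lambda>\<omega>. (X \<omega>, R \<omega>))"
    using ind unfolding indep_var_distribution_eq by auto
  interpret X: prob_space "distr M borel X" by (rule prob_space_distr) measurable
  interpret R: prob_space "distr M borel R" by (rule prob_space_distr) measurable
  interpret P: pair_prob_space "distr M borel X" "distr M borel R" ..
  define S where "S = {(x, y). \<bar>x * d + y\<bar> < \<rho>}"
  have S_sets[measurable]: "S \<in> sets (borel \<Otimes>\<^sub>M borel)"
  proof -
    have "{p \<in> space (borel \<Otimes>\<^sub>M borel). \<bar>fst p * d + snd p\<bar> < \<rho>} \<in> sets (borel \<Otimes>\<^sub>M borel)"
      by measurable
    also have "{p \<in> space (borel \<Otimes>\<^sub>M borel). \<bar>fst p * d + snd p\<bar> < \<rho>} = S"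
      by (auto simp: S_def space_pair_measure)
    finally show ?thesis .
  qed
  have fib: "emeasure (distr M borel X) ((\<lambda>x. (x, y)) -` S) \<le> ennreal (\<rho> / (\<alpha> * \<bar>d\<bar>))" for y
  proof -
    have "(\<lambda>x. (x, y)) -` S \<subseteq> {- y / d - \<rho> / \<bar>d\<bar> .. - y / d + \<rho> / \<bar>d\<bar>}"
    proof
      fix x assume "x \<in> (\<lambda>x. (x, y)) -` S"
      then have "\<bar>x * d + y\<bar> < \<rho>" by (simp add: S_def)
      moreover have "x - (- y / d) = (x * d + y) / d" using \<open>d \<noteq> 0\<close> by (simp add: field_simps)
      ultimately have "\<bar>x - (- y / d)\<bar> \<le> \<rho> / \<bar>d\<bar>"
        by (simp add: abs_divide divide_right_mono)
      then show "x \<in> {- y / d - \<rho> / \<bar>d\<bar> .. - y / d + \<rho> / \<bar>d\<bar>}" by (auto simp: abs_le_iff)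
    qed
    moreover have [measurable]: "(\<lambda>x. (x, y)) -` S \<in> sets borel"
      by (rule sets_Pair2[where ?M2.0=borel]) measurable
    ultimately have "emeasure lborel ({-\<alpha><..<\<alpha>} \<inter> ((\<lambda>x. (x, y)) -` S))
        \<le> emeasure lborel {- y / d - \<rho> / \<bar>d\<bar> .. - y / d + \<rho> / \<bar>d\<bar>}"
      by (intro emeasure_mono) auto
    also have "\<dots> = ennreal (2 * \<rho> / \<bar>d\<bar>)" using \<open>0 < \<rho>\<close> by simp
    finally have "emeasure (distr M borel X) ((\<lambda>x. (x, y)) -` S) \<le> ennreal (2 * \<rho> / \<bar>d\<bar>) / ennreal (2 * \<alpha>)"
      unfolding X using \<open>0 < \<alpha>\<close> by (subst emeasure_uniform_measure) (auto intro!: divide_right_mono_ennreal)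
    also have "\<dots> = ennreal (\<rho> / (\<alpha> * \<bar>d\<bar>))"
      using \<open>0 < \<rho>\<close> \<open>0 < \<alpha>\<close> by (simp add: divide_ennreal field_simps)
    finally show ?thesis .
  qed
  have "emeasure M {\<omega> \<in> space M. \<bar>X \<omega> * d + R \<omega>\<bar> < \<rho>} = emeasure (distr M (borel \<Otimes>\<^sub>M borel) (\<lambda>\<omega>. (X \<omega>, R \<omega>))) S"
    by (subst emeasure_distr[OF _ S_sets]) (auto simp: S_def intro!: arg_cong[where f="emeasure M"])
  also have "\<dots> = (\<integral>\<^sup>+y. emeasure (distr M borel X) ((\<lambda>x. (x, y)) -` S) \<partial>distr M borel R)"
    unfolding joint[symmetric] by (rule P.emeasure_pair_measure_alt2) (simp cong: sets_pair_measure_cong)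
  also have "\<dots> \<le> (\<integral>\<^sup>+y. ennreal (\<rho> / (\<alpha> * \<bar>d\<bar>)) \<partial>distr M borel R)"
    by (intro nn_integral_mono fib)
  also have "\<dots> = ennreal (\<rho> / (\<alpha> * \<bar>d\<bar>))"
    using R.emeasure_space_1 by simp
  finally show ?thesis .
qed

text \<open>All terms but the \<open>n\<close>-th add up to a variable independent of
  \<open>A n\<close>, so the affine bound applies. Every \<open>n\<close> with
  \<open>d n \<noteq> 0\<close> gives such an estimate; the choice of a good one is left to the
  application.\<close>

lemma (in prob_space) uniform_series_small_ball:
  fixes A :: "nat \<Rightarrow> 'a \<Rightarrow> real" and d :: "nat \<Rightarrow> real"
  assumes ind: "indep_vars (\<lambda>_. borel) A UNIV"
    and unif: "distr M borel (A n) = uniform_measure lborel {-\<alpha><..<\<alpha>}"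
    and sum: "AE \<omega> in M. summable (\<lambda>k. A k \<omega> * d k)"
    and "0 < \<alpha>" "d n \<noteq> 0" "0 < \<rho>"
  shows "emeasure M {\<omega> \<in> space M. \<bar>\<Sum>k. A k \<omega> * d k\<bar> < \<rho>} \<le> ennreal (\<rho> / (\<alpha> * \<bar>d n\<bar>))"
proof -
  have [measurable]: "random_variable borel (A k)" for k
    using ind unfolding indep_vars_def by auto
  \<comment> \<open>Replacing the \<open>n\<close>-th term by 0 makes \<open>R\<close> a function of
    the other variables alone. As \<open>suminf\<close> is total, \<open>R\<close> is defined
    everywhere and measurable; summability enters only almost surely, when the sum is split.\<close>
  define R where "R \<omega> = (\<Sum>k. if k = n then 0 else A k \<omega> * d k)" for \<omega>
  have [measurable]: "random_variable borel R" unfolding R_def by measurable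
  have "indep_var borel ((\<lambda>h. h n) \<circ> (\<lambda>\<omega>. restrict (\<lambda>i. A i \<omega>) {n}))
      borel ((\<lambda>h. \<Sum>k. if k = n then 0 else h k * d k) \<circ> (\<lambda>\<omega>. restrict (\<lambda>i. A i \<omega>) (- {n})))"
  proof (rule indep_var_compose[OF indep_var_restrict[OF ind]])
    have "(\<lambda>h. if k = n then 0 else h k * d k) \<in> borel_measurable (Pi\<^sub>M (- {n}) (\<lambda>_. borel))" for k
      by (cases "k = n") auto
    then show "(\<lambda>h. \<Sum>k. if k = n then 0 else h k * d k) \<in> borel_measurable (Pi\<^sub>M (- {n}) (\<lambda>_. borel))"
      by (rule borel_measurable_suminf)
  qed auto
  also have "(\<lambda>h. h n) \<circ> (\<lambda>\<omega>. restrict (\<lambda>i. A i \<omega>) {n}) = A n" by auto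
  also have "(\<lambda>h. \<Sum>k. if k = n then 0 else h k * d k) \<circ> (\<lambda>\<omega>. restrict (\<lambda>i. A i \<omega>) (- {n})) = R"
    by (auto simp: R_def fun_eq_iff intro!: arg_cong[where f=suminf])
  finally have iv: "indep_var borel (A n) borel R" .
  have "emeasure M {\<omega> \<in> space M. \<bar>\<Sum>k. A k \<omega> * d k\<bar> < \<rho>} = emeasure M {\<omega> \<in> space M. \<bar>A n \<omega> * d n + R \<omega>\<bar> < \<rho>}"
  proof (rule emeasure_eq_AE)
    show "AE \<omega> in M. (\<omega> \<in> {\<omega> \<in> space M. \<bar>\<Sum>k. A k \<omega> * d k\<bar> < \<rho>}) = (\<omega> \<in> {\<omega> \<in> space M. \<bar>A n \<omega> * d n + R \<omega>\<bar> < \<rho>})"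
      using sum
    proof eventually_elim
      case (elim \<omega>)
      have s: "(\<lambda>k. if k = n then A n \<omega> * d n else 0) sums (A n \<omega> * d n)"
        using sums_single[of n "\<lambda>k. A k \<omega> * d k"] by (simp cong: if_cong)
      from sums_diff[OF summable_sums[OF elim] s]
      have "(\<lambda>k. if k = n then 0 else A k \<omega> * d k) sums ((\<Sum>k. A k \<omega> * d k) - A n \<omega> * d n)"
        by (rule back_subst[where P="\<lambda>f. f sums _"]) auto
      then have "R \<omega> = (\<Sum>k. A k \<omega> * d k) - A n \<omega> * d n"
        unfolding R_def by (rule sums_unique[symmetric])
      then show ?case by simp
    qed
  qed measurable
  also have "\<dots> \<le> ennreal (\<rho> / (\<alpha> * \<bar>d n\<bar>))"
    by (rule uniform_affine_small_ball[OF iv unif]) fact+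
  finally show ?thesis .
qed

text \<open>Taking expectations of the energies and exchanging integrals leaves, for each pair of
  points, a small ball probability divided by its radius, which \<open>W\<close> bounds
  independently of the radius. By Fatou the lower limit of the energies has finite expectation,
  hence is finite almost surely.\<close>

lemma (in prob_space) AE_abs_cont_L2_density_distr:
  fixes N :: "'b measure" and f :: "'a \<Rightarrow> 'b \<Rightarrow> real" and W :: "'b \<Rightarrow> 'b \<Rightarrow> ennreal"
  assumes N: "finite_measure N"
    and f[measurable]: "case_prod f \<in> borel_measurable (M \<Otimes>\<^sub>M N)"
    and W: "\<And>x y \<rho>. x \<in> space N \<Longrightarrow> y \<in> space N \<Longrightarrow> 0 < \<rho> \<Longrightarrow>
      emeasure M {\<omega> \<in> space M. \<bar>f \<omega> x - f \<omega> y\<bar> < \<rho>} \<le> ennreal \<rho> * W x y"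
    and finW: "(\<integral>\<^sup>+x. (\<integral>\<^sup>+y. W x y \<partial>N) \<partial>N) < \<infinity>"
  shows "AE \<omega> in M. abs_cont_L2_density (distr N borel (f \<omega>))"
proof -
  interpret N: finite_measure N by fact
  interpret MN: pair_sigma_finite M N ..
  define r :: "nat \<Rightarrow> real" where "r k = inverse (real (Suc k))" for k
  have r: "0 < r k" "r \<longlonglongrightarrow> 0" for k
    unfolding r_def by (simp, rule LIMSEQ_inverse_real_of_nat)
  define I :: "nat \<Rightarrow> 'a \<Rightarrow> 'b \<Rightarrow> 'b \<Rightarrow> ennreal"
    where "I k \<omega> x y = indicator {z. \<bar>z\<bar> < 2 * r k} (f \<omega> x - f \<omega> y)" for k \<omega> x y
  define e where "e k \<omega> = (\<integral>\<^sup>+x. (\<integral>\<^sup>+y. I k \<omega> x y \<partial>N) \<partial>N) / ennreal (2 * r k)" for k \<omega>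
  have [measurable]: "(\<lambda>\<omega>. \<integral>\<^sup>+x. (\<integral>\<^sup>+y. I k \<omega> x y \<partial>N) \<partial>N) \<in> borel_measurable M" for k
    unfolding I_def by measurable
  have [measurable]: "e k \<in> borel_measurable M" for k
    unfolding e_def by measurable
  \<comment> \<open>Pulls the energy of the image measure back to \<open>N\<close>, which does not
    depend on \<open>\<omega>\<close>, so that Fubini applies.\<close>
  have energy: "(\<integral>\<^sup>+u. emeasure (distr N borel (f \<omega>)) {v. \<bar>u - v\<bar> < 2 * r k} \<partial>distr N borel (f \<omega>)) / ennreal (2 * r k) = e k \<omega>"
    if \<omega>: "\<omega> \<in> space M" for k \<omega>
  proof -
    have [measurable]: "f \<omega> \<in> borel_measurable N"
      using measurable_Pair2[OF f \<omega>] by simp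
    have em: "emeasure (distr N borel (f \<omega>)) {v. \<bar>u - v\<bar> < 2 * r k} =
        (\<integral>\<^sup>+y. indicator {z. \<bar>z\<bar> < 2 * r k} (u - f \<omega> y) \<partial>N)" for u
    proof -
      have "emeasure (distr N borel (f \<omega>)) {v. \<bar>u - v\<bar> < 2 * r k} =
          (\<integral>\<^sup>+v. indicator {v. \<bar>u - v\<bar> < 2 * r k} v \<partial>distr N borel (f \<omega>))"
        by (rule nn_integral_indicator[symmetric]) measurable
      also have "\<dots> = (\<integral>\<^sup>+y. indicator {v. \<bar>u - v\<bar> < 2 * r k} (f \<omega> y) \<partial>N)"
        by (rule nn_integral_distr) measurable
      finally show ?thesis by (simp add: indicator_def)
    qed
    show ?thesis
      unfolding em e_def I_def by (subst nn_integral_distr) auto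
  qed
  have "(\<integral>\<^sup>+\<omega>. liminf (\<lambda>k. e k \<omega>) \<partial>M) \<le> liminf (\<lambda>k. \<integral>\<^sup>+\<omega>. e k \<omega> \<partial>M)"
    by (rule nn_integral_liminf) measurable
  also have "\<dots> \<le> (\<integral>\<^sup>+x. (\<integral>\<^sup>+y. W x y \<partial>N) \<partial>N)"
  proof (intro Liminf_le always_eventually allI)
    fix k
    have "(\<integral>\<^sup>+\<omega>. (\<integral>\<^sup>+x. (\<integral>\<^sup>+y. I k \<omega> x y \<partial>N) \<partial>N) \<partial>M) = (\<integral>\<^sup>+x. (\<integral>\<^sup>+\<omega>. (\<integral>\<^sup>+y. I k \<omega> x y \<partial>N) \<partial>M) \<partial>N)"
      by (rule MN.Fubini'[symmetric]) (unfold I_def, measurable)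
    also have "\<dots> = (\<integral>\<^sup>+x. (\<integral>\<^sup>+y. (\<integral>\<^sup>+\<omega>. I k \<omega> x y \<partial>M) \<partial>N) \<partial>N)"
      by (intro nn_integral_cong MN.Fubini'[symmetric]) (unfold I_def, measurable)
    also have "(\<integral>\<^sup>+x. (\<integral>\<^sup>+y. (\<integral>\<^sup>+\<omega>. I k \<omega> x y \<partial>M) \<partial>N) \<partial>N) / ennreal (2 * r k) =
        (\<integral>\<^sup>+x. (\<integral>\<^sup>+y. (\<integral>\<^sup>+\<omega>. I k \<omega> x y \<partial>M) \<partial>N) / ennreal (2 * r k) \<partial>N)"
      by (rule nn_integral_divide[symmetric]) (unfold I_def, measurable)
    also have "\<dots> = (\<integral>\<^sup>+x. (\<integral>\<^sup>+y. (\<integral>\<^sup>+\<omega>. I k \<omega> x y \<partial>M) / ennreal (2 * r k) \<partial>N) \<partial>N)"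
      by (intro nn_integral_cong nn_integral_divide[symmetric]) (unfold I_def, measurable)
    also have "\<dots> \<le> (\<integral>\<^sup>+x. (\<integral>\<^sup>+y. W x y \<partial>N) \<partial>N)"
    proof (intro nn_integral_mono)
      fix x y assume xy: "x \<in> space N" "y \<in> space N"
      have [measurable]: "(\<lambda>\<omega>. f \<omega> z) \<in> borel_measurable M" if "z \<in> space N" for z
        using measurable_Pair1[OF f that] by simp
      have "(\<integral>\<^sup>+\<omega>. I k \<omega> x y \<partial>M) = (\<integral>\<^sup>+\<omega>. indicator {\<omega> \<in> space M. \<bar>f \<omega> x - f \<omega> y\<bar> < 2 * r k} \<omega> \<partial>M)"
        by (intro nn_integral_cong) (auto simp: I_def indicator_def)
      also have "\<dots> = emeasure M {\<omega> \<in> space M. \<bar>f \<omega> x - f \<omega> y\<bar> < 2 * r k}"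
        using xy by (intro nn_integral_indicator) measurable
      also have "\<dots> \<le> W x y * ennreal (2 * r k)"
        using W[OF xy, of "2 * r k"] r(1)[of k] by (simp add: mult.commute)
      finally have "(\<integral>\<^sup>+\<omega>. I k \<omega> x y \<partial>M) / ennreal (2 * r k) \<le> W x y * ennreal (2 * r k) / ennreal (2 * r k)"
        by (rule divide_right_mono_ennreal)
      then show "(\<integral>\<^sup>+\<omega>. I k \<omega> x y \<partial>M) / ennreal (2 * r k) \<le> W x y"
        using r(1)[of k] by (simp add: ennreal_mult_divide_eq)
    qed
    finally show "(\<integral>\<^sup>+\<omega>. e k \<omega> \<partial>M) \<le> (\<integral>\<^sup>+x. (\<integral>\<^sup>+y. W x y \<partial>N) \<partial>N)"
      unfolding e_def by (simp add: nn_integral_divide)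
  qed simp
  finally have "(\<integral>\<^sup>+\<omega>. liminf (\<lambda>k. e k \<omega>) \<partial>M) \<noteq> \<infinity>"
    using finW by auto
  then have "AE \<omega> in M. liminf (\<lambda>k. e k \<omega>) \<noteq> \<infinity>"
    by (intro nn_integral_PInf_AE) measurable
  then show ?thesis
  proof (rule AE_mp[OF _ AE_I2], intro impI)
    fix \<omega> assume \<omega>: "\<omega> \<in> space M" and fin: "liminf (\<lambda>k. e k \<omega>) \<noteq> \<infinity>"
    have [measurable]: "f \<omega> \<in> borel_measurable N"
      using measurable_Pair2[OF f \<omega>] by simp
    show "abs_cont_L2_density (distr N borel (f \<omega>))"
    proof (rule abs_cont_L2_densityI_energy[OF _ _ r])
      show "finite_measure (distr N borel (f \<omega>))"
        by (rule N.finite_measure_distr) measurable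
      show "liminf (\<lambda>k. (\<integral>\<^sup>+u. emeasure (distr N borel (f \<omega>)) {v. \<bar>u - v\<bar> < 2 * r k} \<partial>distr N borel (f \<omega>)) / ennreal (2 * r k)) < \<infinity>"
        using fin by (simp add: energy[OF \<omega>] less_top)
    qed simp
  qed
qed

section \<open>Occupation measures of random series\<close>

text \<open>Passing to the next tested index costs a factor \<open>1 / a ^ L\<close> in the small
  ball bound, while the bound for the set of points that get so far shrinks by
  \<open>\<kappa> \<le> a ^ L / 2\<close>. The terms of the resulting series are therefore halved at
  each step.\<close>

lemma (in prob_space) AE_abs_cont_L2_density_random_series:
  fixes g :: "real \<Rightarrow> real" and A :: "nat \<Rightarrow> 'a \<Rightarrow> real" and bs \<theta> :: "nat \<Rightarrow> real"
  assumes T: "0 < T" and periodic: "\<And>x. g (x + T) = g x"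
    and diff: "\<And>x. g differentiable (at x)"
    and crit: "finite {x \<in> {0..T}. deriv g x = 0}"
    and a: "0 < a" "a < 1"
    and ind: "indep_vars (\<lambda>_. borel) A UNIV"
    and unif: "\<And>n. distr M borel (A n) = uniform_measure lborel {-(a ^ n)<..<a ^ n}"
    and b: "1 < b" "\<And>n. 0 < n \<Longrightarrow> b \<le> bs (Suc n) / bs n" and ab: "1 < a * b"
  shows "AE \<omega> in M. abs_cont_L2_density (occupation_measure T (random_series A g bs \<theta> \<omega>))"
proof -
  have cont: "continuous_on UNIV g"
    by (meson diff continuous_at_imp_continuous_on differentiable_imp_continuous_within)
  have [measurable]: "g \<in> borel_measurable borel"
    using cont by (rule borel_measurable_continuous_onI)
  have [measurable]: "random_variable borel (A k)" for k
    using ind unfolding indep_vars_def by auto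
  obtain G where G: "\<And>x. \<bar>g x\<bar> \<le> G"
  proof -
    have "compact (g ` {0..T})"
      using continuous_on_subset[OF cont] by (intro compact_continuous_image) auto
    then obtain G where G: "\<And>x. x \<in> {0..T} \<Longrightarrow> \<bar>g x\<bar> \<le> G"
      by (metis bounded_real compact_imp_bounded imageI)
    have "\<bar>g x\<bar> \<le> G" for x
    proof -
      interpret periodic_fun_simple g T by standard (use periodic in auto)
      have "x - of_int \<lfloor>x / T\<rfloor> * T \<in> {0..T}"
        using floor_divide_lower[OF T, of x] floor_divide_upper[OF T, of x] by (auto simp: algebra_simps)
      then show ?thesis using G minus_of_int[of x "\<lfloor>x / T\<rfloor>"] by metis
    qed
    then show ?thesis by (rule that)
  qed
  have nz: "bs n \<noteq> 0" if "0 < n" for n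
    using b(1) b(2)[OF that] by auto
  \<comment> \<open>Absolute values, because the \<open>bs n\<close> with \<open>n > 0\<close> may
    all be negative.\<close>
  have growth: "b * \<bar>bs n\<bar> \<le> \<bar>bs (Suc n)\<bar>" if "0 < n" for n
  proof -
    have "b \<le> \<bar>bs (Suc n)\<bar> / \<bar>bs n\<bar>"
      using b(2)[OF that] abs_ge_self[of "bs (Suc n) / bs n"] by (simp add: abs_divide)
    then show ?thesis using nz[OF that] by (simp add: pos_le_divide_eq)
  qed
  have growth_pow: "b ^ l * \<bar>bs n\<bar> \<le> \<bar>bs (n + l)\<bar>" if "0 < n" for n l
  proof (induction l)
    case (Suc l)
    have "b * (b ^ l * \<bar>bs n\<bar>) \<le> b * \<bar>bs (n + l)\<bar>"
      using Suc b(1) by (intro mult_left_mono) auto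
    also have "\<dots> \<le> \<bar>bs (n + Suc l)\<bar>" using growth[of "n + l"] that by simp
    finally show ?case by (simp add: mult.assoc)
  qed simp
  define m where "m = Suc (card {x \<in> {0..T}. deriv g x = 0})"
  have m: "0 < real m" by (simp add: m_def)
  \<comment> \<open>This \<open>L\<close> makes the summand \<open>2 / b ^ L\<close> contribute at
    most \<open>a ^ L / 4\<close> to \<open>\<kappa>\<close>, and \<open>\<epsilon>\<close> below is
    chosen so that the other summand contributes exactly \<open>a ^ L / 4\<close>.\<close>
  obtain L where L: "8 * real m < (a * b) ^ L" using real_arch_pow[OF ab] by blast
  have "L \<noteq> 0" using L by (cases L) (auto simp: m_def)
  define \<epsilon> where "\<epsilon> = a ^ L * T / (8 * real m)"
  have \<epsilon>: "0 < \<epsilon>" using a T m by (simp add: \<epsilon>_def)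
  obtain \<delta> where \<delta>: "0 < \<delta>" and cover: "\<And>c. \<exists>S. finite S \<and> card S \<le> m \<and>
            {u \<in> {0..T}. \<bar>g u - c\<bar> < \<delta>} \<subseteq> (\<Union>s\<in>S. {s-\<epsilon>..s+\<epsilon>})"
    using level_set_cover[OF diff crit \<epsilon>] unfolding m_def by blast
  define \<kappa> where "\<kappa> = real m * (2 * \<epsilon> / T + 2 / b ^ L)"
  have \<kappa>: "0 \<le> \<kappa>" "\<kappa> \<le> a ^ L / 2"
  proof -
    show "0 \<le> \<kappa>" using \<epsilon> T b by (simp add: \<kappa>_def)
    have "real m * (2 * \<epsilon> / T) = a ^ L / 4" using T m by (simp add: \<epsilon>_def field_simps)
    moreover have "real m * (2 / b ^ L) \<le> a ^ L / 4"
      using L b by (simp add: field_simps power_mult_distrib)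
    ultimately have "\<kappa> \<le> a ^ L / 4 + a ^ L / 4"
      unfolding \<kappa>_def distrib_left by (intro add_mono) auto
    then show "\<kappa> \<le> a ^ L / 2" by simp
  qed
  \<comment> \<open>The indices begin at \<open>L\<close> rather than 0, since the growth of
    \<open>bs\<close> is known only from index 1 on.\<close>
  define n where "n j = L * Suc j" for j
  have n: "0 < n j" for j using \<open>L \<noteq> 0\<close> by (simp add: n_def)
  define D where "D k x y = g (bs k * x + \<theta> k) - g (bs k * y + \<theta> k)" for k x y
  define N where "N = restrict_space lborel {0..T}"
  have N: "finite_measure N"
    unfolding N_def by (intro finite_measureI) (auto simp: emeasure_restrict_space space_restrict_space emeasure_lborel_Icc_eq)
  \<comment> \<open>Only the term at the first \<open>j\<close> with
    \<open>\<delta> \<le> \<bar>D (n j) x y\<bar>\<close> is wanted. Its indicator asks just for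
    smallness at the earlier indices, so the sum over all \<open>j\<close> is an upper bound, and
    the integral of each term is controlled by nested level sets.\<close>
  define W :: "real \<Rightarrow> real \<Rightarrow> ennreal" where
    "W x y = (\<Sum>j. ennreal (1 / (\<delta> * a ^ n j)) * indicator {y. \<forall>i<j. \<bar>D (n i) x y\<bar> < \<delta>} y)" for x y
  have AE_A: "AE \<omega> in M. \<forall>k. \<bar>A k \<omega>\<bar> \<le> a ^ k"
  proof -
    have "AE \<omega> in M. \<bar>A k \<omega>\<bar> \<le> a ^ k" for k
    proof -
      have "AE x in uniform_measure lborel {-(a ^ k)<..<a ^ k}. \<bar>x\<bar> \<le> a ^ k"
        using a by (intro AE_uniform_measureI) auto
      then have "AE x in distr M borel (A k). \<bar>x\<bar> \<le> a ^ k" unfolding unif .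
      then show ?thesis by (subst (asm) AE_distr_iff) auto
    qed
    then show ?thesis by (simp add: AE_all_countable)
  qed
  have summ: "summable (\<lambda>k. A k \<omega> * c k)" if "\<forall>k. \<bar>A k \<omega>\<bar> \<le> a ^ k" "\<And>k. \<bar>c k\<bar> \<le> H" for \<omega> c H
  proof (rule summable_comparison_test')
    show "summable (\<lambda>k. a ^ k * H)" using a by (intro summable_mult2 summable_geometric) auto
    show "norm (A k \<omega> * c k) \<le> a ^ k * H" for k
      using that a by (auto simp: abs_mult intro!: mult_mono)
  qed
  have small: "emeasure M {\<omega> \<in> space M. \<bar>random_series A g bs \<theta> \<omega> x - random_series A g bs \<theta> \<omega> y\<bar> < \<rho>}
      \<le> ennreal (\<rho> / (a ^ k * \<bar>D k x y\<bar>))" if "0 < \<rho>" "D k x y \<noteq> 0" for x y k \<rho>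
  proof -
    have "emeasure M {\<omega> \<in> space M. \<bar>random_series A g bs \<theta> \<omega> x - random_series A g bs \<theta> \<omega> y\<bar> < \<rho>}
        = emeasure M {\<omega> \<in> space M. \<bar>\<Sum>i. A i \<omega> * D i x y\<bar> < \<rho>}"
    proof (rule emeasure_eq_AE)
      show "AE \<omega> in M. (\<omega> \<in> {\<omega> \<in> space M. \<bar>random_series A g bs \<theta> \<omega> x - random_series A g bs \<theta> \<omega> y\<bar> < \<rho>})
          = (\<omega> \<in> {\<omega> \<in> space M. \<bar>\<Sum>i. A i \<omega> * D i x y\<bar> < \<rho>})"
        using AE_A
      proof eventually_elim
        case (elim \<omega>)
        \<comment> \<open>The series are subtracted term by term where both converge, which is
          guaranteed almost surely by \<open>AE_A\<close>.\<close>
        have "random_series A g bs \<theta> \<omega> x - random_series A g bs \<theta> \<omega> y = (\<Sum>i. A i \<omega> * D i x y)"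
          unfolding random_series_def D_def right_diff_distrib
          by (rule suminf_diff) (rule summ[OF elim G])+
        then show ?case by simp
      qed
    qed (unfold random_series_def, measurable)
    also have "\<dots> \<le> ennreal (\<rho> / (a ^ k * \<bar>D k x y\<bar>))"
    proof (rule uniform_series_small_ball[OF ind unif])
      have DG: "\<bar>D k x y\<bar> \<le> 2 * G" for k
        using G[of "bs k * x + \<theta> k"] G[of "bs k * y + \<theta> k"] by (simp add: D_def)
      show "AE \<omega> in M. summable (\<lambda>k. A k \<omega> * D k x y)"
        using AE_A by eventually_elim (rule summ[OF _ DG])
    qed (use that a in auto)
    finally show ?thesis .
  qed
  have W: "emeasure M {\<omega> \<in> space M. \<bar>random_series A g bs \<theta> \<omega> x - random_series A g bs \<theta> \<omega> y\<bar> < \<rho>}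
      \<le> ennreal \<rho> * W x y" (is "?P \<le> _") if "0 < \<rho>" for x y \<rho>
  proof -
    have "\<exists>j. (\<forall>i<j. \<bar>D (n i) x y\<bar> < \<delta>) \<and> ?P \<le> ennreal (\<rho> * (1 / (\<delta> * a ^ n j)))"
    proof (cases "\<exists>j. \<delta> \<le> \<bar>D (n j) x y\<bar>")
      case True
      define J where "J = (LEAST j. \<delta> \<le> \<bar>D (n j) x y\<bar>)"
      have J: "\<delta> \<le> \<bar>D (n J) x y\<bar>" using LeastI_ex[OF True] by (simp add: J_def)
      have "\<bar>D (n i) x y\<bar> < \<delta>" if "i < J" for i
        using not_less_Least[of i "\<lambda>j. \<delta> \<le> \<bar>D (n j) x y\<bar>"] that by (auto simp: J_def)
      moreover have "?P \<le> ennreal (\<rho> / (a ^ n J * \<bar>D (n J) x y\<bar>))"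
        using J \<delta> that by (intro small) auto
      moreover have "\<rho> / (a ^ n J * \<bar>D (n J) x y\<bar>) \<le> \<rho> / (a ^ n J * \<delta>)"
        using J \<delta> that a by (intro divide_left_mono mult_left_mono mult_pos_pos) auto
      ultimately show ?thesis
        by (intro exI[of _ J]) (auto simp: mult.commute intro: order_trans ennreal_leI)
    next
      case False
      \<comment> \<open>No tested index separates this pair. Far enough out the weight alone is at
        least \<open>1 / \<rho>\<close>, and the trivial bound 1 for a probability suffices.\<close>
      obtain j where j: "a ^ j < \<rho> / \<delta>"
        using real_arch_pow_inv[of "\<rho> / \<delta>" a] a \<delta> \<open>0 < \<rho>\<close> by auto
      have "a ^ n j \<le> a ^ j"
        using a \<open>L \<noteq> 0\<close> by (intro power_decreasing) (auto simp: n_def intro: trans_le_add2)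
      with j have "a ^ n j < \<rho> / \<delta>" by simp
      then have "1 \<le> \<rho> * (1 / (\<delta> * a ^ n j))"
        using \<delta> a by (simp add: field_simps)
      then have "ennreal 1 \<le> ennreal (\<rho> * (1 / (\<delta> * a ^ n j)))" by (rule ennreal_leI)
      then have "?P \<le> ennreal (\<rho> * (1 / (\<delta> * a ^ n j)))"
        unfolding ennreal_1 by (rule order_trans[OF measure_le_1])
      then show ?thesis using False by (auto simp: not_le intro!: exI[of _ j])
    qed
    then obtain j where j: "\<forall>i<j. \<bar>D (n i) x y\<bar> < \<delta>" "?P \<le> ennreal (\<rho> * (1 / (\<delta> * a ^ n j)))"
      by blast
    have le: "ennreal (1 / (\<delta> * a ^ n j)) \<le> W x y"
      unfolding W_def using sum_le_suminf[of "\<lambda>j. ennreal (1 / (\<delta> * a ^ n j)) * indicator {y. \<forall>i<j. \<bar>D (n i) x y\<bar> < \<delta>} y" "{j}"] j(1)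
      by simp
    note j(2)
    also have "ennreal (\<rho> * (1 / (\<delta> * a ^ n j))) = ennreal \<rho> * ennreal (1 / (\<delta> * a ^ n j))"
      using that \<delta> a by (intro ennreal_mult) auto
    also have "\<dots> \<le> ennreal \<rho> * W x y"
      using le by (rule mult_left_mono) simp
    finally show ?thesis .
  qed
  \<comment> \<open>The last factor of the bound for nested level sets, with \<open>l = T\<close>
    and first frequency \<open>bs (n 0)\<close>.\<close>
  define K where "K = T + 2 * T / \<bar>bs (n 0)\<bar>"
  have K: "0 \<le> K" using T by (simp add: K_def)
  have inner: "(\<integral>\<^sup>+y. indicator {y. \<forall>i<j. \<bar>D (n i) x y\<bar> < \<delta>} y \<partial>N) \<le> ennreal (\<kappa> ^ j * K)" for x j
  proof -
    \<comment> \<open>\<open>0+T\<close> gives the interval the shape \<open>{p..p+l}\<close> of the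
      level set bound; the values of \<open>g\<close> belonging to the fixed \<open>x\<close> act as
      the constants \<open>c\<close>.\<close>
    define E where "E = {y \<in> {0..0+T}. \<forall>i<j. \<bar>g (bs (n i) * y + \<theta> (n i)) - g (bs (n i) * x + \<theta> (n i))\<bar> < \<delta>}"
    have [measurable]: "E \<in> sets borel" unfolding E_def by measurable
    have "(\<integral>\<^sup>+y. indicator {y. \<forall>i<j. \<bar>D (n i) x y\<bar> < \<delta>} y \<partial>N) =
        (\<integral>\<^sup>+y. indicator {y. \<forall>i<j. \<bar>D (n i) x y\<bar> < \<delta>} y * indicator {0..T} y \<partial>lborel)"
      unfolding N_def by (rule nn_integral_restrict_space) simp
    also have "\<dots> = (\<integral>\<^sup>+y. indicator E y \<partial>lborel)"
      by (intro nn_integral_cong) (auto simp: E_def D_def indicator_def abs_minus_commute)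
    also have "\<dots> = ennreal (measure lborel E)"
    proof -
      have "emeasure lborel E \<le> emeasure lborel {0..0+T}" by (intro emeasure_mono) (auto simp: E_def)
      then have "emeasure lborel E \<noteq> \<infinity>" by (auto simp: emeasure_lborel_Icc_eq top_unique)
      then show ?thesis by (simp add: emeasure_eq_ennreal_measure)
    qed
    also have "measure lborel E \<le> \<kappa> ^ j * K"
      unfolding E_def \<kappa>_def K_def
    proof (rule nested_level_sets_measure[OF T periodic cont \<epsilon> _ cover])
      show "b ^ L * \<bar>bs (n i)\<bar> \<le> \<bar>bs (n (Suc i))\<bar>" for i
        using growth_pow[OF n[of i], of L] by (simp add: n_def add.commute)
    qed (use b T n nz in auto)
    finally show ?thesis by (simp add: ennreal_leI)
  qed
  have ind_meas: "(\<lambda>y. indicator {y. \<forall>i<j. \<bar>D (n i) x y\<bar> < \<delta>} y :: ennreal) \<in> borel_measurable N" for x j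
    unfolding N_def D_def by (intro measurable_restrict_space1) measurable
  have "(\<integral>\<^sup>+x. (\<integral>\<^sup>+y. W x y \<partial>N) \<partial>N) < \<infinity>"
  proof -
    \<comment> \<open>\<open>a ^ n j\<close> is \<open>(a ^ L) ^ Suc j\<close>, so
      \<open>(a ^ L / 2) ^ j\<close> cancels all but one of its factors \<open>a ^ L\<close> and
      leaves a geometric series of ratio 1/2.\<close>
    have Wx: "(\<integral>\<^sup>+y. W x y \<partial>N) \<le> (\<Sum>j. ennreal (K / (\<delta> * a ^ L) * (1 / 2) ^ j))" for x
    proof -
      have "(\<integral>\<^sup>+y. W x y \<partial>N) = (\<Sum>j. \<integral>\<^sup>+y. ennreal (1 / (\<delta> * a ^ n j)) * indicator {y. \<forall>i<j. \<bar>D (n i) x y\<bar> < \<delta>} y \<partial>N)"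
        unfolding W_def by (rule nn_integral_suminf) (intro borel_measurable_times_ennreal borel_measurable_const ind_meas)
      also have "\<dots> = (\<Sum>j. ennreal (1 / (\<delta> * a ^ n j)) * (\<integral>\<^sup>+y. indicator {y. \<forall>i<j. \<bar>D (n i) x y\<bar> < \<delta>} y \<partial>N))"
        by (intro arg_cong[where f=suminf] ext nn_integral_cmult ind_meas)
      also have "\<dots> \<le> (\<Sum>j. ennreal (K / (\<delta> * a ^ L) * (1 / 2) ^ j))"
      proof (intro suminf_le summableI)
        fix j
        have "ennreal (1 / (\<delta> * a ^ n j)) * (\<integral>\<^sup>+y. indicator {y. \<forall>i<j. \<bar>D (n i) x y\<bar> < \<delta>} y \<partial>N)
            \<le> ennreal (1 / (\<delta> * a ^ n j)) * ennreal (\<kappa> ^ j * K)"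
          by (intro mult_left_mono inner) simp
        also have "\<dots> = ennreal (1 / (\<delta> * a ^ n j) * (\<kappa> ^ j * K))"
          using \<delta> a \<kappa> K by (intro ennreal_mult[symmetric]) auto
        also have "\<dots> \<le> ennreal (1 / (\<delta> * a ^ n j) * ((a ^ L / 2) ^ j * K))"
          using \<delta> a \<kappa> K by (intro ennreal_leI mult_left_mono mult_right_mono power_mono) auto
        also have "1 / (\<delta> * a ^ n j) * ((a ^ L / 2) ^ j * K) = K / (\<delta> * a ^ L) * (1 / 2) ^ j"
        proof -
          have "a ^ n j = a ^ L * (a ^ L) ^ j" by (simp add: n_def power_add power_mult)
          moreover have "(a ^ L) ^ j \<noteq> 0" using a by simp
          ultimately show ?thesis by (simp add: power_divide)
        qed
        finally show "ennreal (1 / (\<delta> * a ^ n j)) * (\<integral>\<^sup>+y. indicator {y. \<forall>i<j. \<bar>D (n i) x y\<bar> < \<delta>} y \<partial>N)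
            \<le> ennreal (K / (\<delta> * a ^ L) * (1 / 2) ^ j)" .
      qed
      finally show ?thesis .
    qed
    have fin: "(\<Sum>j. ennreal (K / (\<delta> * a ^ L) * (1 / 2) ^ j)) \<noteq> \<top>"
      using K \<delta> a by (intro ennreal_suminf_neq_top summable_mult summable_geometric) auto
    have "(\<integral>\<^sup>+x. (\<integral>\<^sup>+y. W x y \<partial>N) \<partial>N) \<le> (\<integral>\<^sup>+x. (\<Sum>j. ennreal (K / (\<delta> * a ^ L) * (1 / 2) ^ j)) \<partial>N)"
      by (intro nn_integral_mono Wx)
    also have "\<dots> < \<infinity>"
      using fin finite_measure.emeasure_finite[OF N] by (simp add: ennreal_mult_less_top less_top)
    finally show ?thesis .
  qed
  moreover have "case_prod (random_series A g bs \<theta>) \<in> borel_measurable (M \<Otimes>\<^sub>M N)"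
  proof -
    have "(\<lambda>x. x) \<in> measurable N borel"
      unfolding N_def by (intro measurable_restrict_space1) simp
    from measurable_compose[OF measurable_snd this]
    have [measurable]: "snd \<in> measurable (M \<Otimes>\<^sub>M N) borel" .
    show ?thesis unfolding random_series_def split_beta' by measurable
  qed
  ultimately show ?thesis
    unfolding occupation_measure_def N_def[symmetric]
    by (intro AE_abs_cont_L2_density_distr[OF N _ W])
qed

theorem theoremB:
  fixes g :: "real \<Rightarrow> real" and T a :: real
    and M :: "'w measure" and A :: "nat \<Rightarrow> 'w \<Rightarrow> real"
  assumes T_pos: "T > 0"
    and periodic: "\<forall>x. g (x + T) = g x"
    and C1: "(\<forall>x. g differentiable (at x)) \<and> continuous_on UNIV (deriv g)"
    and crit: "\<forall>c d. finite {x \<in> {c..d}. deriv g x = 0}"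
    and a: "0 < a" "a < 1"
    and P: "prob_space M"
    and indep: "prob_space.indep_vars M (\<lambda>_. borel) A UNIV"
    and unif: "\<forall>n. distr M borel (A n) = uniform_measure lborel {-(a ^ n)<..<a ^ n}"
  shows "(\<forall>(bs :: nat \<Rightarrow> real) (\<theta> :: nat \<Rightarrow> real) (b :: real).
            b > 1 \<and> (\<forall>n>0. bs (Suc n) / bs n \<ge> b) \<and> a\<^sup>2 * b > 1 \<longrightarrow>
            (AE \<omega> in M. abs_cont_L2_density (occupation_measure T (random_series A g bs \<theta> \<omega>))))
       \<and> (\<forall>b :: nat. b > 1 \<and> a * real b > 1 \<longrightarrow>
            (AE \<omega> in M. abs_cont_L2_density
               (occupation_measure T (random_series A g (\<lambda>n. real b ^ n) (\<lambda>n. 0) \<omega>))))"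
proof -
  interpret prob_space M by (rule P)
  note conclusion = AE_abs_cont_L2_density_random_series
    [OF T_pos periodic[rule_format] conjunct1[OF C1, rule_format] crit[rule_format] a indep unif[rule_format]]
  show ?thesis
  proof (intro conjI allI impI)
    fix bs \<theta> :: "nat \<Rightarrow> real" and b :: real
    assume b: "b > 1 \<and> (\<forall>n>0. bs (Suc n) / bs n \<ge> b) \<and> a\<^sup>2 * b > 1"
    \<comment> \<open>With \<open>a < 1\<close> this yields \<open>1 < a * b\<close>, the condition
      under which \<open>conclusion\<close> applies.\<close>
    have "a\<^sup>2 * b \<le> a * b"
      using a b by (intro mult_right_mono) (auto simp: power2_eq_square)
    with b have "1 < a * b" by linarith
    with b show "AE \<omega> in M. abs_cont_L2_density (occupation_measure T (random_series A g bs \<theta> \<omega>))"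
      by (intro conclusion[of b]) auto
  next
    fix b :: nat
    assume b: "b > 1 \<and> a * real b > 1"
    then show "AE \<omega> in M. abs_cont_L2_density
        (occupation_measure T (random_series A g (\<lambda>n. real b ^ n) (\<lambda>n. 0) \<omega>))"
      by (intro conclusion[of "real b"]) auto
  qed
qed

end
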